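(* There exists a nuclear regular Köthe space $E$ with the properties $\underline{DN}$ and $\Omega$ such that, for its associated exponent sequence $\varepsilon$, one has $\Delta(E)=\Delta(\Lambda_{1}(\varepsilon))$ and there is no subspace of $E$ which is isomorphic to $\Lambda_{1}(\varepsilon)$.
   Context: **Köthe spaces.** A Köthe matrix is a matrix $(a_{k,n})_{k,n\ge1}$ of non-negative numbers such that for each $n$ there is $k$ with $a_{k,n}>0$, and $a_{k,n}\le a_{k+1,n}$ for all $k,n$. The Köthe space is $K(a_{k,n})=\{x=(x_n)_{n\ge1}:\|x\|_k=\sum_{n}|x_n|a_{k,n}<\infty\ \forall k\}$, a Fréchet space with these seminorms. It is called regular if $\frac{a_{k+1,n}}{a_{k,n}}\le\frac{a_{k+1,n+1}}{a_{k,n+1}}$ for all $k,n\ge1$ (the entries being positive). **Diameters.** For absolutely convex sets $U,V$ in a Fréchet space $E$ with $V\subseteq CU$ for some $C>0$, the $n$-th Kolmogorov diameter ($n=0,1,2,\dots$) is $d_n(V,U)=\inf\{t>0:\ V\subseteq tU+L \text{ for some linear subspace } L\subseteq E,\ \dim L\le n\}$. **Diametral dimension.** Let $(\|\cdot\|_k)_{k\ge1}$ be an increasing fundamental sequence of seminorms of $E$ and $U_k=\{x\in E:\|x\|_k\le1\}$. The diametral dimension is $$\Delta(E)=\{(t_n)_{n\ge 0}:\ \forall p\ \exists q>p\ \lim_{n\to\infty}t_n d_n(U_q,U_p)=0\}$$ (a set of scalar sequences, independent of the choice of seminorms). **Property $\underline{DN}$:** $\exists k\ \forall j\ \exists l,\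 C>0,\ 0<\lambda<1$ with $\|x\|_j\le C\|x\|_k^{\lambda}\|x\|_l^{1-\lambda}$ for all $x\in E$. **Property $\Omega$:** $\forall p\ \exists q\ \forall k\ \exists C>0,\ 0<\theta<1$ with $\|y\|_q^*\le C(\|y\|_p^* )^{1-\theta}(\|y\|_k^* )^{\theta}$ for all $y\in E'$, where $\|y\|_k^*=\sup\{|y(x)|:\|x\|_k\le1\}\in[0,+\infty]$. **Power series spaces.** An exponent sequence is a non-negative increasing sequence $\alpha=(\alpha_n)_{n\ge0}$ with $\alpha_n\to+\infty$. Then $\Lambda_1(\alpha)=\{x=(x_n)_{n\ge 0}:\|x\|_k=\sum_n|x_n|e^{-\alpha_n/k}<\infty\ \forall k\ge1\}$ and $\Lambda_\infty(\alpha)=\{x:\|x\|_k=\sum_n|x_n|e^{k\alpha_n}<\infty\ \forall k\ge1\}$, with the Fréchet topologies given by these norms. The dual $\Lambda_\infty(\alpha)'$ is identified with the sequence space $\{(t_n):\exists k\ \sup_n|t_n|e^{-k\alpha_n}<\infty\}$. **Associated exponent sequence.** For a nuclear Fréchet space $E$ with $\underline{DN}$ and $\Omega$ there is (known fact) an exponent sequence $\varepsilon=(\varepsilon_n)_{n\ge0}$, unique up to equivalence (each of two equivalent sequences is bounded by a constant multiple of the other, up to finitely many terms), such that $\Delta(\Lambda_1(\varepsilon))\subseteq\Delta(E)\subseteq\Delta(\Lambda_\infty(\varepsilon))$ and, for every exponent sequence $\alpha$: $\Lambda_1(\alpha)\subseteq\Delta(E)$ implies $\Lambda_1(\alpha)\subseteq\Lambda_1(\varepsilon)$,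 and $\Delta(E)\subseteq\Lambda_\infty(\alpha)'$ implies $\Lambda_\infty(\varepsilon)'\subseteq\Lambda_\infty(\alpha)'$. This $\varepsilon$ is called the associated exponent sequence of $E$. "Subspace" means linear subspace with the induced topology, and "isomorphic" means linearly homeomorphic. *)

theory Defs
  imports "HOL-Analysis.Analysis" "HOL-Library.Function_Algebras"
begin

text \<open>
  All spaces are linear subspaces \<open>E\<close> of the space of scalar sequences, together with a sequence
  \<open>p 0, p 1, \<dots>\<close> of seminorms on \<open>E\<close> (increasing, and fundamental for the topology of \<open>E\<close>).
  Seminorms and sequence entries that are traditionally numbered from 1 are numbered from 0.
  The scalar field is a commutative real normed field which is a Euclidean space, i.e. the real
  or the complex numbers.
\<close>

section \<open>Linear structure\<close>

definition scale_seq :: "'a::real_normed_field \<Rightarrow> (nat \<Rightarrow> 'a) \<Rightarrow> (nat \<Rightarrow> 'a)" where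
  "scale_seq c x = (\<lambda>n. c * x n)"

global_interpretation seq: vector_space "scale_seq :: 'a::real_normed_field \<Rightarrow> (nat \<Rightarrow> 'a) \<Rightarrow> _"
  by unfold_locales (auto simp: scale_seq_def fun_eq_iff algebra_simps)

definition dim_at_most :: "(nat \<Rightarrow> 'a::real_normed_field) set \<Rightarrow> nat \<Rightarrow> bool" where
  "dim_at_most L n \<longleftrightarrow> (\<exists>B. seq.independent B \<and> seq.span B = L \<and> finite B \<and> card B \<le> n)"

text \<open>Linearity on \<open>E\<close>; the parameter \<open>s\<close> is the scalar multiplication of the codomain.\<close>

definition linear_map_on ::
  "(nat \<Rightarrow> 'a::real_normed_field) set \<Rightarrow> ('a \<Rightarrow> 'b \<Rightarrow> 'b) \<Rightarrow> ((nat \<Rightarrow> 'a) \<Rightarrow> 'b::ab_group_add) \<Rightarrow> bool" where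
  "linear_map_on E s f \<longleftrightarrow>
     (\<forall>x\<in>E. \<forall>y\<in>E. f (x + y) = f x + f y) \<and> (\<forall>c. \<forall>x\<in>E. f (scale_seq c x) = s c (f x))"

section \<open>Topology, dual space and isomorphic subspaces\<close>

definition seminorm_topology ::
  "(nat \<Rightarrow> 'a::real_normed_field) set \<Rightarrow> (nat \<Rightarrow> (nat \<Rightarrow> 'a) \<Rightarrow> real) \<Rightarrow> (nat \<Rightarrow> 'a) topology" where
  "seminorm_topology E p =
     topology_generated_by {{y\<in>E. p k (y - x) < r} | k x r. x \<in> E \<and> 0 < r}"

definition unit_ball ::
  "(nat \<Rightarrow> 'a::real_normed_field) set \<Rightarrow> (nat \<Rightarrow> (nat \<Rightarrow> 'a) \<Rightarrow> real) \<Rightarrow> nat \<Rightarrow> (nat \<Rightarrow> 'a) set" where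
  "unit_ball E p k = {x\<in>E. p k x \<le> 1}"

text \<open>Functionals are total functions; only their values on \<open>E\<close> matter.\<close>

definition dual_space ::
  "(nat \<Rightarrow> 'a::real_normed_field) set \<Rightarrow> (nat \<Rightarrow> (nat \<Rightarrow> 'a) \<Rightarrow> real) \<Rightarrow> ((nat \<Rightarrow> 'a) \<Rightarrow> 'a) set" where
  "dual_space E p =
     {f. linear_map_on E (*) f \<and> continuous_map (seminorm_topology E p) euclidean f}"

definition dual_norm ::
  "(nat \<Rightarrow> 'a::real_normed_field) set \<Rightarrow> (nat \<Rightarrow> (nat \<Rightarrow> 'a) \<Rightarrow> real) \<Rightarrow> nat \<Rightarrow> ((nat \<Rightarrow> 'a) \<Rightarrow> 'a) \<Rightarrow> ennreal" where
  "dual_norm E p k f = (SUP x\<in>unit_ball E p k. ennreal (norm (f x)))"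

definition isomorphic_to_subspace ::
  "(nat \<Rightarrow> 'a::real_normed_field) set \<Rightarrow> (nat \<Rightarrow> (nat \<Rightarrow> 'a) \<Rightarrow> real) \<Rightarrow>
   (nat \<Rightarrow> 'a) set \<Rightarrow> (nat \<Rightarrow> (nat \<Rightarrow> 'a) \<Rightarrow> real) \<Rightarrow> bool" where
  "isomorphic_to_subspace G q E p \<longleftrightarrow>
     (\<exists>F T. F \<subseteq> E \<and> seq.subspace F \<and> linear_map_on G scale_seq T \<and>
        homeomorphic_map (seminorm_topology G q) (subtopology (seminorm_topology E p) F) T)"

section \<open>Nuclearity\<close>

text \<open>
  Pietsch's definition: every canonical map from \<open>E\<close> with seminorm \<open>p l\<close> to \<open>E\<close> with seminorm
  \<open>p k\<close>, for suitable \<open>l\<close> depending on \<open>k\<close>, has a nuclear representation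
  \<open>x = (\<Sum>j. f j x \<cdot> y j)\<close>, where \<open>f j\<close> is a linear form continuous with respect to \<open>p l\<close>.
\<close>

definition nuclear_space ::
  "(nat \<Rightarrow> 'a::real_normed_field) set \<Rightarrow> (nat \<Rightarrow> (nat \<Rightarrow> 'a) \<Rightarrow> real) \<Rightarrow> bool" where
  "nuclear_space E p \<longleftrightarrow>
     (\<forall>k. \<exists>l\<ge>k. \<exists>f y.
        (\<forall>j. linear_map_on E (*) (f j) \<and> dual_norm E p l (f j) < \<infinity> \<and> y j \<in> E) \<and>
        (\<Sum>j. dual_norm E p l (f j) * ennreal (p k (y j))) < \<infinity> \<and>
        (\<forall>x\<in>E. (\<lambda>N. p k (x - (\<Sum>j<N. scale_seq (f j x) (y j)))) \<longlonglongrightarrow> 0))"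

section \<open>Diameters and diametral dimension\<close>

definition kolmogorov_diameter ::
  "(nat \<Rightarrow> 'a::real_normed_field) set \<Rightarrow> (nat \<Rightarrow> 'a) set \<Rightarrow> (nat \<Rightarrow> 'a) set \<Rightarrow> nat \<Rightarrow> real" where
  "kolmogorov_diameter E V U n =
     Inf {t. 0 < t \<and> (\<exists>L. L \<subseteq> E \<and> seq.subspace L \<and> dim_at_most L n \<and>
                        V \<subseteq> {scale_seq (of_real t) u + z | u z. u \<in> U \<and> z \<in> L})}"

definition diametral_dimension ::
  "(nat \<Rightarrow> 'a::real_normed_field) set \<Rightarrow> (nat \<Rightarrow> (nat \<Rightarrow> 'a) \<Rightarrow> real) \<Rightarrow> (nat \<Rightarrow> 'a) set" where
  "diametral_dimension E p =
     {t. \<forall>k. \<exists>l>k.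
        (\<lambda>n. t n * of_real (kolmogorov_diameter E (unit_ball E p l) (unit_ball E p k) n)) \<longlonglongrightarrow> 0}"

section \<open>The linear topological invariants\<close>

definition property_DN_underlined ::
  "(nat \<Rightarrow> 'a::real_normed_field) set \<Rightarrow> (nat \<Rightarrow> (nat \<Rightarrow> 'a) \<Rightarrow> real) \<Rightarrow> bool" where
  "property_DN_underlined E p \<longleftrightarrow>
     (\<exists>k. \<forall>j. \<exists>l C \<theta>. 0 < C \<and> 0 < \<theta> \<and> \<theta> < 1 \<and>
        (\<forall>x\<in>E. p j x \<le> C * p k x powr \<theta> * p l x powr (1 - \<theta>)))"

definition ennreal_powr :: "ennreal \<Rightarrow> real \<Rightarrow> ennreal" where
  "ennreal_powr t s = (if t = \<infinity> then \<infinity> else ennreal (enn2real t powr s))"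

text \<open>
  The convention \<open>0 * \<infinity> = 0\<close> is harmless below: \<open>dual_norm E p m f = 0\<close> forces \<open>f = 0\<close> on \<open>E\<close>,
  and then all dual norms of \<open>f\<close> vanish.
\<close>

definition property_Omega ::
  "(nat \<Rightarrow> 'a::real_normed_field) set \<Rightarrow> (nat \<Rightarrow> (nat \<Rightarrow> 'a) \<Rightarrow> real) \<Rightarrow> bool" where
  "property_Omega E p \<longleftrightarrow>
     (\<forall>m. \<exists>q. \<forall>k. \<exists>(C::real) \<theta>. 0 < C \<and> 0 < \<theta> \<and> \<theta> < 1 \<and>
        (\<forall>f\<in>dual_space E p.
           dual_norm E p q f \<le>
             ennreal C * ennreal_powr (dual_norm E p m f) (1 - \<theta>) * ennreal_powr (dual_norm E p k f) \<theta>))"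

section \<open>Koethe spaces\<close>

definition koethe_matrix :: "(nat \<Rightarrow> nat \<Rightarrow> real) \<Rightarrow> bool" where
  "koethe_matrix a \<longleftrightarrow>
     (\<forall>k n. 0 \<le> a k n) \<and> (\<forall>n. \<exists>k. 0 < a k n) \<and> (\<forall>k n. a k n \<le> a (Suc k) n)"

definition regular_matrix :: "(nat \<Rightarrow> nat \<Rightarrow> real) \<Rightarrow> bool" where
  "regular_matrix a \<longleftrightarrow>
     (\<forall>k n. 0 < a k n) \<and>
     (\<forall>k n. a (Suc k) n / a k n \<le> a (Suc k) (Suc n) / a k (Suc n))"

definition koethe_space :: "(nat \<Rightarrow> nat \<Rightarrow> real) \<Rightarrow> (nat \<Rightarrow> 'a::real_normed_field) set" where
  "koethe_space a = {x. \<forall>k. summable (\<lambda>n. norm (x n) * a k n)}"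

definition koethe_norm :: "(nat \<Rightarrow> nat \<Rightarrow> real) \<Rightarrow> nat \<Rightarrow> (nat \<Rightarrow> 'a::real_normed_field) \<Rightarrow> real" where
  "koethe_norm a k x = (\<Sum>n. norm (x n) * a k n)"

section \<open>Power series spaces and the associated exponent sequence\<close>

definition exponent_sequence :: "(nat \<Rightarrow> real) \<Rightarrow> bool" where
  "exponent_sequence \<alpha> \<longleftrightarrow> (\<forall>n. 0 \<le> \<alpha> n) \<and> mono \<alpha> \<and> filterlim \<alpha> at_top sequentially"

text \<open>
  The power series spaces are the Koethe spaces of the following matrices; the \<open>Suc\<close> restores the
  numbering of the seminorms from 1.
\<close>

definition power_series_matrix_1 :: "(nat \<Rightarrow> real) \<Rightarrow> nat \<Rightarrow> nat \<Rightarrow> real" where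
  "power_series_matrix_1 \<alpha> k n = exp (- \<alpha> n / real (Suc k))"

definition power_series_matrix_inf :: "(nat \<Rightarrow> real) \<Rightarrow> nat \<Rightarrow> nat \<Rightarrow> real" where
  "power_series_matrix_inf \<alpha> k n = exp (real (Suc k) * \<alpha> n)"

abbreviation Lambda_1 :: "(nat \<Rightarrow> real) \<Rightarrow> (nat \<Rightarrow> 'a::real_normed_field) set" where
  "Lambda_1 \<alpha> \<equiv> koethe_space (power_series_matrix_1 \<alpha>)"

abbreviation Lambda_1_norm :: "(nat \<Rightarrow> real) \<Rightarrow> nat \<Rightarrow> (nat \<Rightarrow> 'a::real_normed_field) \<Rightarrow> real" where
  "Lambda_1_norm \<alpha> \<equiv> koethe_norm (power_series_matrix_1 \<alpha>)"

abbreviation Lambda_inf :: "(nat \<Rightarrow> real) \<Rightarrow> (nat \<Rightarrow> 'a::real_normed_field) set" where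
  "Lambda_inf \<alpha> \<equiv> koethe_space (power_series_matrix_inf \<alpha>)"

abbreviation Lambda_inf_norm :: "(nat \<Rightarrow> real) \<Rightarrow> nat \<Rightarrow> (nat \<Rightarrow> 'a::real_normed_field) \<Rightarrow> real" where
  "Lambda_inf_norm \<alpha> \<equiv> koethe_norm (power_series_matrix_inf \<alpha>)"

text \<open>The dual of \<open>Lambda_inf \<alpha>\<close>, identified with a space of sequences.\<close>

definition Lambda_inf_dual :: "(nat \<Rightarrow> real) \<Rightarrow> (nat \<Rightarrow> 'a::real_normed_field) set" where
  "Lambda_inf_dual \<alpha> = {t. \<exists>k. bdd_above (range (\<lambda>n. norm (t n) * exp (- real k * \<alpha> n)))}"

definition associated_exponent_sequence ::
  "(nat \<Rightarrow> 'a::real_normed_field) set \<Rightarrow> (nat \<Rightarrow> (nat \<Rightarrow> 'a) \<Rightarrow> real) \<Rightarrow> (nat \<Rightarrow> real) \<Rightarrow> bool" where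
  "associated_exponent_sequence E p \<epsilon> \<longleftrightarrow>
     exponent_sequence \<epsilon> \<and>
     diametral_dimension (Lambda_1 \<epsilon>) (Lambda_1_norm \<epsilon>) \<subseteq> diametral_dimension E p \<and>
     diametral_dimension E p \<subseteq> diametral_dimension (Lambda_inf \<epsilon>) (Lambda_inf_norm \<epsilon>) \<and>
     (\<forall>\<alpha>. exponent_sequence \<alpha> \<longrightarrow>
        (Lambda_1 \<alpha> \<subseteq> diametral_dimension E p \<longrightarrow> (Lambda_1 \<alpha> :: (nat \<Rightarrow> 'a) set) \<subseteq> Lambda_1 \<epsilon>) \<and>
        (diametral_dimension E p \<subseteq> Lambda_inf_dual \<alpha> \<longrightarrow>
           (Lambda_inf_dual \<epsilon> :: (nat \<Rightarrow> 'a) set) \<subseteq> Lambda_inf_dual \<alpha>))"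

end

theory Submission
  imports Defs "HOL-Library.Nat_Bijection"
begin

text \<open>
  Let \<open>\<epsilon> n = (n!)\<^sup>3\<close> (the constant \<open>expo\<close>), and let \<open>m n \<le> n\<close> (the constant \<open>jump\<close>) take
  every natural value infinitely often. The space is the Koethe space of
  \<open>a k n = exp (\<epsilon> n * s k n)\<close>, where \<open>s k n = - 1 / (k + 1)\<close> for \<open>k \<le> m n\<close> and
  \<open>s k n = m n - 1 / (k + 1)\<close> for \<open>k > m n\<close>. This is the matrix of \<open>\<Lambda>\<^sub>1(\<epsilon>)\<close>, except that
  the \<open>n\<close>-th column gains the additional factor \<open>exp (\<epsilon> n * m n)\<close> once the index of the seminorm
  passes \<open>m n\<close>. The size of the jump is unbounded, but a large jump occurs at a late seminorm only.

  For fixed \<open>k\<close> the numbers \<open>s k n\<close> are bounded in \<open>n\<close>, and \<open>s (k + 1) n - s k n\<close> is bounded below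
  by the positive number \<open>1 / ((k + 1) * (k + 2))\<close>. Hence the space has \<open>DN\<close> and \<open>\<Omega>\<close>, and the
  rapid growth of \<open>\<epsilon>\<close> gives nuclearity and, since \<open>m n \<le> n\<close>, regularity.

  The diametral dimension does not see the jumps. For a regular matrix the diameters are the quotients
  \<open>a k n / a l n\<close>. If \<open>t\<close> belongs to the diametral dimension, choose \<open>k < l < l'\<close>, with \<open>k\<close> large,
  such that \<open>t\<close> is controlled by the quotients of the steps from \<open>k\<close> to \<open>l\<close> and from \<open>l\<close> to
  \<open>l'\<close>. For each \<open>n\<close> the jump lies outside one of the two steps, and there the quotient is at least
  \<open>exp (- \<epsilon> n / (k + 1))\<close>. So \<open>t n\<close> grows more slowly than every \<open>exp (\<delta> * \<epsilon> n)\<close>, which is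
  membership in \<open>\<Delta>(\<Lambda>\<^sub>1(\<epsilon>))\<close> (lemma \<open>diametral_dimension_jump_space\<close>).

  A subspace isomorphic to \<open>\<Lambda>\<^sub>1(\<epsilon>)\<close> would see them. Some nonzero combination of the images of the
  first \<open>n + 1\<close> unit sequences has vanishing first \<open>n\<close> coordinates, and comparing the seminorms of
  this single vector in both spaces gives a uniform estimate: for some \<open>p\<close> and every
  \<open>q \<ge> p\<close>, the quotient \<open>a q n / a p n\<close> is at most a constant times \<open>exp (\<epsilon> n)\<close>
  (lemma \<open>isomorphic_subspace_ratio_bound\<close>). This fails along the infinitely many \<open>n\<close> with
  \<open>m n = M\<close>, for \<open>M \<ge> p\<close> large, where \<open>a (M + 1) n / a p n \<ge> exp (M * \<epsilon> n)\<close>. Every other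
  associated exponent sequence is bounded by a multiple of \<open>\<epsilon> + 1\<close>
  (lemma \<open>associated_exponent_sequence_unique\<close>), so the same comparison excludes it.
\<close>

section \<open>Homogeneous linear systems\<close>

text \<open>
  Gaussian elimination. The lemma is stated with explicit coefficients because it is applied both to
  the images of unit sequences and to a basis of a subspace.
\<close>

lemma homogeneous_system_nontrivial_solution:
  fixes c :: "'i \<Rightarrow> 'j \<Rightarrow> 'a::field"
  assumes "finite I" "finite J" "card I < card J"
  shows "\<exists>x. (\<exists>j\<in>J. x j \<noteq> 0) \<and> (\<forall>i\<in>I. (\<Sum>j\<in>J. c i j * x j) = 0)"
  using assms
proof (induction I arbitrary: J c rule: finite_induct)
  case empty
  then obtain j where "j \<in> J" by fastforce
  then show ?case by (intro exI[of _ "\<lambda>_. 1"]) auto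
next
  case (insert i I)
  show ?case
  proof (cases "\<forall>j\<in>J. c i j = 0")
    case True
    from insert obtain x where "\<exists>j\<in>J. x j \<noteq> 0" "\<forall>i\<in>I. (\<Sum>j\<in>J. c i j * x j) = 0"
      by (metis Suc_lessD card_insert_disjoint)
    with True show ?thesis by (intro exI[of _ x]) auto
  next
    case False
    then obtain j0 where j0: "j0 \<in> J" "c i j0 \<noteq> 0" by auto
    define K where "K = J - {j0}"
    have K: "finite K" "j0 \<notin> K" "J = insert j0 K" using j0 insert.prems by (auto simp: K_def)
    then have "card I < card K" using insert by simp
    from insert.IH[OF K(1) this, of "\<lambda>i' j. c i' j - c i' j0 * (c i j / c i j0)"]
    obtain x where x: "\<exists>j\<in>K. x j \<noteq> 0"
      and eq: "\<And>i'. i' \<in> I \<Longrightarrow> (\<Sum>j\<in>K. (c i' j - c i' j0 * (c i j / c i j0)) * x j) = 0"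
      by blast
    define s where "s = (\<Sum>j\<in>K. c i j * x j) / c i j0"
    define y where "y = x(j0 := - s)"
    have sum_y: "(\<Sum>j\<in>J. c i' j * y j) = (\<Sum>j\<in>K. c i' j * x j) - c i' j0 * s" for i'
    proof -
      have "(\<Sum>j\<in>K. c i' j * y j) = (\<Sum>j\<in>K. c i' j * x j)"
        by (rule sum.cong) (use K in \<open>auto simp: y_def\<close>)
      then show ?thesis using K by (simp add: y_def)
    qed
    have "(\<Sum>j\<in>J. c i' j * y j) = 0" if "i' \<in> insert i I" for i'
    proof (cases "i' = i")
      case True
      then show ?thesis unfolding sum_y using j0 by (simp add: s_def)
    next
      case False
      have "(\<Sum>j\<in>K. (c i' j - c i' j0 * (c i j / c i j0)) * x j)
          = (\<Sum>j\<in>K. c i' j * x j) - c i' j0 * s"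
        by (simp add: s_def sum_subtractf sum_distrib_left sum_divide_distrib algebra_simps)
      then show ?thesis using eq[of i'] that False by (simp add: sum_y)
    qed
    moreover have "\<exists>j\<in>J. y j \<noteq> 0" using x K by (auto simp: y_def)
    ultimately show ?thesis by blast
  qed
qed

section \<open>Sequences and Koethe spaces\<close>

definition unit_seq :: "nat \<Rightarrow> nat \<Rightarrow> 'a::real_normed_field" where
  "unit_seq n = (\<lambda>i. if i = n then 1 else 0)"

definition truncate :: "nat \<Rightarrow> (nat \<Rightarrow> 'a) \<Rightarrow> nat \<Rightarrow> 'a::real_normed_field" where
  "truncate N x = (\<lambda>i. if i < N then x i else 0)"

lemma truncate_eq_sum: "truncate N x = (\<Sum>j<N. scale_seq (x j) (unit_seq j))"
proof
  fix i
  have "(\<Sum>j<N. scale_seq (x j) (unit_seq j)) i = (\<Sum>j<N. if i = j then x j else 0)"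
    by (induction N) (auto simp: scale_seq_def unit_seq_def)
  then show "truncate N x i = (\<Sum>j<N. scale_seq (x j) (unit_seq j)) i"
    by (simp add: truncate_def)
qed

lemma koethe_nonneg: "koethe_matrix a \<Longrightarrow> 0 \<le> a k n"
  by (simp add: koethe_matrix_def)

lemma koethe_mono: "koethe_matrix a \<Longrightarrow> k \<le> l \<Longrightarrow> a k n \<le> a l n"
  by (rule lift_Suc_mono_le[of "\<lambda>k. a k n"]) (auto simp: koethe_matrix_def)

lemma koethe_spaceD: "x \<in> koethe_space a \<Longrightarrow> summable (\<lambda>n. norm (x n) * a k n)"
  by (simp add: koethe_space_def)

lemma koethe_norm_finite_support:
  assumes "\<And>i. N \<le> i \<Longrightarrow> x i = 0"
  shows "x \<in> koethe_space a" "koethe_norm a k x = (\<Sum>i<N. norm (x i) * a k i)"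
proof -
  have "(\<lambda>n. norm (x n) * a k n) sums (\<Sum>i<N. norm (x i) * a k i)" for k
    by (rule sums_finite) (use assms in auto)
  then show "x \<in> koethe_space a" "koethe_norm a k x = (\<Sum>i<N. norm (x i) * a k i)"
    by (auto simp: koethe_space_def koethe_norm_def sums_iff)
qed

lemma truncate_in_koethe: "truncate N x \<in> koethe_space a"
  by (rule koethe_norm_finite_support[of N]) (auto simp: truncate_def)

lemma unit_seq_in_koethe: "unit_seq n \<in> koethe_space a"
  by (rule koethe_norm_finite_support[of "Suc n"]) (auto simp: unit_seq_def)

lemma koethe_norm_unit_seq: "koethe_norm a k (unit_seq n) = a k n"
  by (subst koethe_norm_finite_support(2)[of "Suc n"]) (auto simp: unit_seq_def)

lemma koethe_norm_scale:
  assumes "x \<in> koethe_space a"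
  shows "koethe_norm a k (scale_seq c x) = norm c * koethe_norm a k x"
  unfolding koethe_norm_def scale_seq_def norm_mult mult.assoc
  using koethe_spaceD[OF assms] by (rule suminf_mult)

context
  fixes a :: "nat \<Rightarrow> nat \<Rightarrow> real"
  assumes a: "koethe_matrix a"
begin

lemma summable_koethe_add:
  assumes "x \<in> koethe_space a" "y \<in> koethe_space a"
  shows "summable (\<lambda>n. norm (x n + y n) * a k n)"
proof (rule summable_comparison_test_ev)
  show "summable (\<lambda>n. norm (x n) * a k n + norm (y n) * a k n)"
    using assms by (intro summable_add koethe_spaceD)
  show "\<forall>\<^sub>F n in sequentially. norm (norm (x n + y n) * a k n) \<le> norm (x n) * a k n + norm (y n) * a k n"
    using koethe_nonneg[OF a]
    by (intro always_eventually) (auto simp: abs_mult distrib_right[symmetric] norm_triangle_ineq mult_right_mono)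
qed

lemma subspace_koethe_space: "seq.subspace (koethe_space a :: (nat \<Rightarrow> 'a::real_normed_field) set)"
proof (rule seq.subspaceI)
  show "0 \<in> (koethe_space a :: (nat \<Rightarrow> 'a) set)" by (simp add: koethe_space_def)
  show "x + y \<in> koethe_space a" if "x \<in> koethe_space a" "y \<in> koethe_space a" for x y :: "nat \<Rightarrow> 'a"
    using summable_koethe_add[OF that] by (simp add: koethe_space_def)
  show "scale_seq c x \<in> koethe_space a" if "x \<in> koethe_space a" for c and x :: "nat \<Rightarrow> 'a"
    using that by (auto simp: koethe_space_def scale_seq_def norm_mult mult.assoc intro: summable_mult)
qed

lemma koethe_norm_nonneg:
  assumes "x \<in> koethe_space a"
  shows "0 \<le> koethe_norm a k x"
  unfolding koethe_norm_def
  by (intro suminf_nonneg koethe_spaceD assms) (auto simp: koethe_nonneg[OF a])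

lemma koethe_norm_mono:
  assumes "x \<in> koethe_space a" "k \<le> l"
  shows "koethe_norm a k x \<le> koethe_norm a l x"
  unfolding koethe_norm_def
  by (intro suminf_le koethe_spaceD assms mult_left_mono koethe_mono[OF a]) auto

lemma koethe_norm_triangle:
  assumes "x \<in> koethe_space a" "y \<in> koethe_space a"
  shows "koethe_norm a k (x + y) \<le> koethe_norm a k x + koethe_norm a k y"
proof -
  have "koethe_norm a k (x + y) \<le> (\<Sum>n. norm (x n) * a k n + norm (y n) * a k n)"
    unfolding koethe_norm_def plus_fun_def
    by (intro suminf_le summable_add koethe_spaceD assms summable_koethe_add)
       (auto simp: distrib_right[symmetric] norm_triangle_ineq mult_right_mono koethe_nonneg[OF a])
  also have "\<dots> = koethe_norm a k x + koethe_norm a k y"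
    unfolding koethe_norm_def by (intro suminf_add[symmetric] koethe_spaceD assms)
  finally show ?thesis .
qed

lemma koethe_diff:
  assumes "x \<in> koethe_space a" "y \<in> koethe_space a"
  shows "x - y \<in> (koethe_space a :: (nat \<Rightarrow> 'a::real_normed_field) set)"
  using seq.subspace_diff[OF subspace_koethe_space] assms by blast

lemma koethe_norm_coordinate:
  assumes "x \<in> koethe_space a"
  shows "norm (x n) * a k n \<le> koethe_norm a k x"
  using sum_le_suminf[OF koethe_spaceD[OF assms, of k], of "{n}"]
  by (auto simp: koethe_norm_def koethe_nonneg[OF a])

lemma koethe_norm_zero: "koethe_norm a k 0 = 0"
  by (simp add: koethe_norm_def)

lemma koethe_norm_truncation_error:
  assumes "x \<in> koethe_space a"
  shows "(\<lambda>N. koethe_norm a k (x - truncate N x)) \<longlonglongrightarrow> 0"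
proof -
  have "koethe_norm a k (x - truncate N x) = koethe_norm a k x - (\<Sum>i<N. norm (x i) * a k i)" for N
  proof -
    have "summable (\<lambda>n. norm ((x - truncate N x) n) * a k n)"
      by (intro koethe_spaceD koethe_diff assms truncate_in_koethe)
    from suminf_split_initial_segment[OF this, of N]
    have "koethe_norm a k (x - truncate N x) = (\<Sum>n. norm (x (n + N)) * a k (n + N))"
      by (simp add: koethe_norm_def truncate_def)
    then show ?thesis
      using suminf_split_initial_segment[OF koethe_spaceD[OF assms, of k], of N]
      by (simp add: koethe_norm_def)
  qed
  moreover have "(\<lambda>N. koethe_norm a k x - (\<Sum>i<N. norm (x i) * a k i)) \<longlonglongrightarrow> koethe_norm a k x - koethe_norm a k x"
    unfolding koethe_norm_def by (intro tendsto_diff tendsto_const summable_LIMSEQ koethe_spaceD assms)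
  ultimately show ?thesis by simp
qed

section \<open>Topology\<close>

lemma topspace_seminorm_topology:
  "topspace (seminorm_topology (koethe_space a) (koethe_norm a)) = (koethe_space a :: (nat \<Rightarrow> 'a::real_normed_field) set)"
proof -
  have "x \<in> topspace (seminorm_topology (koethe_space a) (koethe_norm a))"
    if "x \<in> koethe_space a" for x :: "nat \<Rightarrow> 'a"
    unfolding seminorm_topology_def topology_generated_by_topspace
    by (rule UnionI[of "{y\<in>koethe_space a. koethe_norm a 0 (y - x) < 1}"])
       (use that in \<open>auto simp: koethe_norm_zero intro!: exI[of _ x] exI[of _ "0::nat"] exI[of _ "1::real"]\<close>)
  then show ?thesis
    by (force simp: seminorm_topology_def topology_generated_by_topspace)
qed

lemma openin_koethe_ball:
  assumes "x \<in> koethe_space a" "0 < r"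
  shows "openin (seminorm_topology (koethe_space a) (koethe_norm a)) {y\<in>koethe_space a. koethe_norm a k (y - x) < r}"
  unfolding seminorm_topology_def by (rule topology_generated_by_Basis) (use assms in auto)

lemma openin_koethe_contains_ball:
  fixes S :: "(nat \<Rightarrow> 'a::real_normed_field) set"
  assumes "openin (seminorm_topology (koethe_space a) (koethe_norm a)) S" "x \<in> S"
  obtains k r where "0 < r" "{y\<in>koethe_space a. koethe_norm a k (y - x) < r} \<subseteq> S"
proof -
  define B where "B = (\<lambda>k (x :: nat \<Rightarrow> 'a) r. {y\<in>koethe_space a. koethe_norm a k (y - x) < r})"
  have inter: "B (max k l) x (min r s) \<subseteq> B k x r \<inter> B l x s" if "x \<in> koethe_space a" for k l x r s
  proof
    fix y assume y: "y \<in> B (max k l) x (min r s)"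
    then have "y - x \<in> koethe_space a" using that by (auto simp: B_def intro: koethe_diff)
    from koethe_norm_mono[OF this, of k "max k l"] koethe_norm_mono[OF this, of l "max k l"]
    show "y \<in> B k x r \<inter> B l x s" using y by (auto simp: B_def)
  qed
  have sub: "B k x (r - koethe_norm a k (x - z)) \<subseteq> B k z r"
    if "x \<in> koethe_space a" "z \<in> koethe_space a" for k x z r
  proof
    fix y assume y: "y \<in> B k x (r - koethe_norm a k (x - z))"
    then have "koethe_norm a k ((y - x) + (x - z)) \<le> koethe_norm a k (y - x) + koethe_norm a k (x - z)"
      using that by (intro koethe_norm_triangle koethe_diff) (auto simp: B_def)
    then show "y \<in> B k z r" using y by (simp add: B_def)
  qed
  have "generate_topology_on {B k x r | k x r. x \<in> koethe_space a \<and> 0 < r} S"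
    using assms(1) by (simp add: seminorm_topology_def openin_topology_generated_by_iff B_def)
  then have "\<forall>x\<in>S. x \<in> koethe_space a \<and> (\<exists>k r. 0 < r \<and> B k x r \<subseteq> S)"
  proof (induction rule: generate_topology_on.induct)
    case Empty
    then show ?case by simp
  next
    case (Int S T)
    show ?case
    proof
      fix x assume "x \<in> S \<inter> T"
      with Int.IH obtain k r l s where "x \<in> koethe_space a" "0 < r" "B k x r \<subseteq> S" "0 < s" "B l x s \<subseteq> T"
        by (meson IntD1 IntD2)
      then show "x \<in> koethe_space a \<and> (\<exists>k r. 0 < r \<and> B k x r \<subseteq> S \<inter> T)"
        using inter[of x k l r s] by (intro conjI exI[of _ "max k l"] exI[of _ "min r s"]) auto
    qed
  next
    case (UN K)
    show ?case
    proof
      fix x assume "x \<in> \<Union> K"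
      then obtain T where T: "T \<in> K" "x \<in> T" by blast
      with UN.IH obtain k r where "x \<in> koethe_space a" "0 < r" "B k x r \<subseteq> T" by meson
      with T show "x \<in> koethe_space a \<and> (\<exists>k r. 0 < r \<and> B k x r \<subseteq> \<Union> K)" by (meson Union_upper order_trans)
    qed
  next
    case (Basis S)
    then obtain k z r where S: "S = B k z r" "z \<in> koethe_space a" by blast
    show ?case
    proof
      fix x assume "x \<in> S"
      then have "x \<in> koethe_space a" "0 < r - koethe_norm a k (x - z)" by (auto simp: S B_def)
      with sub[OF this(1) S(2)] S show "x \<in> koethe_space a \<and> (\<exists>k r. 0 < r \<and> B k x r \<subseteq> S)" by meson
    qed
  qed
  then show ?thesis using assms(2) that unfolding B_def by meson
qed

end

section \<open>Diameters\<close>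

lemma regular_pos: "regular_matrix a \<Longrightarrow> 0 < a k n"
  by (simp add: regular_matrix_def)

lemma regular_ratio_mono:
  assumes "regular_matrix a" "k \<le> l" "i \<le> n"
  shows "a l i / a k i \<le> a l n / a k n"
  using assms(2)
proof (induction l rule: dec_induct)
  case base
  then show ?case using regular_pos[OF assms(1)] by (simp add: less_imp_neq[symmetric])
next
  case (step l)
  have "a (Suc l) i / a l i \<le> a (Suc l) n / a l n"
    by (rule lift_Suc_mono_le[OF _ \<open>i \<le> n\<close>]) (use assms(1) in \<open>auto simp: regular_matrix_def\<close>)
  with step.IH have "(a (Suc l) i / a l i) * (a l i / a k i) \<le> (a (Suc l) n / a l n) * (a l n / a k n)"
    using regular_pos[OF assms(1)] by (intro mult_mono) (auto intro: less_imp_le)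
  then show ?case using regular_pos[OF assms(1)] by (simp add: less_imp_neq[symmetric])
qed

lemma regular_ratio_antimono:
  assumes "regular_matrix a" "k \<le> l" "i \<le> n"
  shows "a k n / a l n \<le> a k i / a l i"
  using regular_ratio_mono[OF assms] regular_pos[OF assms(1)]
  by (simp add: divide_simps mult.commute)

lemma koethe_norm_tail_le:
  assumes a: "koethe_matrix a" "regular_matrix a" and "k \<le> l"
    and x: "x \<in> koethe_space a" "\<And>i. i < n \<Longrightarrow> x i = 0"
  shows "koethe_norm a k x \<le> a k n / a l n * koethe_norm a l x"
proof -
  have "koethe_norm a k x \<le> (\<Sum>i. a k n / a l n * (norm (x i) * a l i))"
    unfolding koethe_norm_def
  proof (intro suminf_le summable_mult koethe_spaceD x)
    fix i
    show "norm (x i) * a k i \<le> a k n / a l n * (norm (x i) * a l i)"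
    proof (cases "i < n")
      case False
      then have "a k i / a l i \<le> a k n / a l n"
        using a \<open>k \<le> l\<close> by (intro regular_ratio_antimono) auto
      then have "a k i \<le> a k n / a l n * a l i"
        using regular_pos[OF a(2)] by (simp add: pos_divide_le_eq)
      from mult_left_mono[OF this norm_ge_zero[of "x i"]] show ?thesis by (simp add: mult_ac)
    qed (simp add: x)
  qed
  also have "\<dots> = a k n / a l n * koethe_norm a l x"
    unfolding koethe_norm_def by (intro suminf_mult koethe_spaceD x)
  finally show ?thesis .
qed

text \<open>
  The span of the first \<open>n\<close> unit sequences is an optimal subspace: cutting off the first \<open>n\<close>
  coordinates leaves a sequence to which the previous estimate applies.
\<close>

lemma kolmogorov_diameter_le:
  fixes a :: "nat \<Rightarrow> nat \<Rightarrow> real"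
  assumes a: "koethe_matrix a" "regular_matrix a" and "k \<le> l"
  defines "E \<equiv> koethe_space a :: (nat \<Rightarrow> 'a::real_normed_field) set"
  shows "\<exists>L. L \<subseteq> E \<and> seq.subspace L \<and> dim_at_most L n \<and>
    unit_ball E (koethe_norm a) l \<subseteq>
      {scale_seq (of_real (a k n / a l n)) u + z | u z. u \<in> unit_ball E (koethe_norm a) k \<and> z \<in> L}"
proof -
  define L where "L = seq.span (unit_seq ` {..<n} :: (nat \<Rightarrow> 'a) set)"
  have trunc: "truncate n x \<in> L" for x
    unfolding truncate_eq_sum L_def
    by (intro seq.span_sum seq.span_scale seq.span_base) auto
  have "L \<subseteq> E"
    unfolding L_def E_def by (intro seq.span_minimal subspace_koethe_space a) (auto simp: unit_seq_in_koethe)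
  moreover have "dim_at_most L n"
  proof -
    obtain B :: "(nat \<Rightarrow> 'a) set" where B: "B \<subseteq> unit_seq ` {..<n}" "seq.independent B" "unit_seq ` {..<n} \<subseteq> seq.span B"
      by (rule seq.maximal_independent_subset)
    have "seq.span B = L"
      unfolding L_def using B by (meson seq.span_eq seq.span_superset order_trans)
    moreover have "finite B" using B by (meson finite_imageI finite_lessThan finite_subset)
    moreover have "card B \<le> n"
      using card_mono[OF _ B(1)] card_image_le[of "{..<n}" "unit_seq :: nat \<Rightarrow> nat \<Rightarrow> 'a"] by simp
    ultimately show ?thesis using B by (auto simp: dim_at_most_def)
  qed
  moreover have "x \<in> {scale_seq (of_real (a k n / a l n)) u + z | u z. u \<in> unit_ball E (koethe_norm a) k \<and> z \<in> L}"
    if x: "x \<in> unit_ball E (koethe_norm a) l" for x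
  proof -
    define d where "d = a k n / a l n"
    have d: "0 < d" using regular_pos[OF a(2)] by (simp add: d_def)
    define y where "y = x - truncate n x"
    have xE: "x \<in> koethe_space a" using x by (simp add: unit_ball_def E_def)
    have yE: "y \<in> koethe_space a" unfolding y_def by (intro koethe_diff a xE truncate_in_koethe)
    have "koethe_norm a l y \<le> koethe_norm a l x"
      unfolding koethe_norm_def
      by (intro suminf_le koethe_spaceD yE xE mult_right_mono koethe_nonneg a) (auto simp: y_def truncate_def)
    also have "\<dots> \<le> 1" using x by (simp add: unit_ball_def)
    finally have "d * koethe_norm a l y \<le> d" using d by simp
    moreover have "koethe_norm a k y \<le> d * koethe_norm a l y"
      unfolding d_def by (rule koethe_norm_tail_le) (use a \<open>k \<le> l\<close> yE in \<open>auto simp: y_def truncate_def\<close>)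
    ultimately have "koethe_norm a k y \<le> d" by simp
    then have "scale_seq (of_real (inverse d)) y \<in> unit_ball E (koethe_norm a) k"
      using d yE seq.subspace_scale[OF subspace_koethe_space[OF a(1)] yE]
      by (simp add: unit_ball_def E_def koethe_norm_scale norm_inverse) (simp add: field_simps)
    moreover have "x = scale_seq (of_real d) (scale_seq (of_real (inverse d)) y) + truncate n x"
      using d by (simp add: y_def scale_seq_def fun_eq_iff flip: mult.assoc)
    ultimately show ?thesis using trunc[of x] unfolding d_def by blast
  qed
  ultimately show ?thesis using seq.subspace_span[of "unit_seq ` {..<n}"] unfolding L_def by blast
qed

text \<open>
  Only the first \<open>n + 1\<close> coordinates matter. On them \<open>L\<close> is annihilated by a nonzero functional \<open>f\<close>,
  because its dimension is at most \<open>n\<close>. With respect to seminorm \<open>k\<close> the functional attains its norm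
  at a unit sequence \<open>j0 \<le> n\<close>; testing the inclusion on the multiple of this unit sequence in the
  smaller ball gives \<open>t \<ge> a k j0 / a l j0\<close>, and regularity passes from \<open>j0\<close> to \<open>n\<close>.
\<close>

lemma kolmogorov_diameter_ge:
  fixes a :: "nat \<Rightarrow> nat \<Rightarrow> real" and L :: "(nat \<Rightarrow> 'a::real_normed_field) set"
  assumes a: "koethe_matrix a" "regular_matrix a" and "k \<le> l"
    and "0 < t" and L: "dim_at_most L n"
    and sub: "unit_ball (koethe_space a) (koethe_norm a) l \<subseteq>
      {scale_seq (of_real t) u + z | u z. u \<in> unit_ball (koethe_space a) (koethe_norm a) k \<and> z \<in> L}"
  shows "a k n / a l n \<le> t"
proof -
  note pos = regular_pos[OF a(2)]
  obtain B where B: "seq.span B = L" "finite B" "card B \<le> n"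
    using L by (auto simp: dim_at_most_def)
  have "\<exists>f. (\<exists>j\<in>{..n}. f j \<noteq> 0) \<and> (\<forall>b\<in>B. (\<Sum>j\<in>{..n}. b j * f j) = 0)"
    by (rule homogeneous_system_nontrivial_solution) (use B in auto)
  then obtain f j1 where j1: "j1 \<le> n" "f j1 \<noteq> 0" and fB: "\<And>b. b \<in> B \<Longrightarrow> (\<Sum>j\<le>n. b j * f j) = 0"
    by auto
  have fL: "(\<Sum>j\<le>n. z j * f j) = 0" if "z \<in> L" for z
    using that unfolding B(1)[symmetric]
  proof (induction rule: seq.span_induct_alt)
    case (step c x y)
    have "(\<Sum>j\<le>n. (scale_seq c x + y) j * f j) = c * (\<Sum>j\<le>n. x j * f j) + (\<Sum>j\<le>n. y j * f j)"
      by (simp add: scale_seq_def algebra_simps sum.distrib sum_distrib_left)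
    then show ?case using step fB by simp
  qed simp
  \<comment> \<open>the norm of \<open>f\<close> dual to seminorm \<open>k\<close> is the maximum of \<open>h\<close>\<close>
  define h where "h = (\<lambda>j. norm (f j) / a k j)"
  obtain j0 where j0: "j0 \<le> n" "\<And>j. j \<le> n \<Longrightarrow> h j \<le> h j0"
  proof -
    have "Max (h ` {..n}) \<in> h ` {..n}" by (intro Max_in) auto
    then obtain j0 where "j0 \<le> n" "h j0 = Max (h ` {..n})" by (metis atMost_iff imageE)
    then show ?thesis using that[of j0] by simp
  qed
  have "0 < h j1" using j1 pos by (simp add: h_def)
  with j0(2)[OF j1(1)] have h: "0 < h j0" by linarith
  define x where "x = scale_seq (of_real (inverse (a l j0))) (unit_seq j0 :: nat \<Rightarrow> 'a)"
  have "x \<in> unit_ball (koethe_space a) (koethe_norm a) l"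
    unfolding x_def unit_ball_def
    using pos seq.subspace_scale[OF subspace_koethe_space[OF a(1)] unit_seq_in_koethe]
    by (auto simp: koethe_norm_scale unit_seq_in_koethe koethe_norm_unit_seq norm_inverse less_imp_le less_imp_neq[symmetric])
  with sub obtain u z where u: "u \<in> koethe_space a" "koethe_norm a k u \<le> 1" and z: "z \<in> L"
    and x: "x = scale_seq (of_real t) u + z" by (auto simp: unit_ball_def)
  have "of_real (inverse (a l j0)) * f j0 = (\<Sum>j\<le>n. x j * f j)"
  proof -
    have "(\<Sum>j\<le>n. x j * f j) = (\<Sum>j\<le>n. if j = j0 then of_real (inverse (a l j0)) * f j0 else 0)"
      by (intro sum.cong) (auto simp: x_def scale_seq_def unit_seq_def)
    then show ?thesis using j0 by simp
  qed
  also have "\<dots> = of_real t * (\<Sum>j\<le>n. u j * f j) + (\<Sum>j\<le>n. z j * f j)"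
    by (simp add: x scale_seq_def algebra_simps sum.distrib sum_distrib_left)
  finally have "norm (f j0) / a l j0 = t * norm (\<Sum>j\<le>n. u j * f j)"
    using fL[OF z] pos[of l j0] \<open>0 < t\<close> by (metis (no_types) abs_of_pos add.right_neutral divide_inverse mult.commute norm_mult norm_of_real positive_imp_inverse_positive)
  also have "norm (\<Sum>j\<le>n. u j * f j) \<le> (\<Sum>j\<le>n. h j0 * (norm (u j) * a k j))"
  proof (rule sum_norm_le)
    fix j assume "j \<in> {..n}"
    then have "norm (f j) \<le> h j0 * a k j" using j0(2)[of j] pos[of k j] by (simp add: h_def pos_divide_le_eq)
    from mult_left_mono[OF this norm_ge_zero[of "u j"]]
    show "norm (u j * f j) \<le> h j0 * (norm (u j) * a k j)" by (simp add: norm_mult mult_ac)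
  qed
  also have "\<dots> = h j0 * (\<Sum>j\<le>n. norm (u j) * a k j)" by (simp add: sum_distrib_left)
  also have "(\<Sum>j\<le>n. norm (u j) * a k j) \<le> koethe_norm a k u"
    unfolding koethe_norm_def
    by (intro sum_le_suminf koethe_spaceD u) (auto simp: koethe_nonneg[OF a(1)])
  also have "koethe_norm a k u \<le> 1" by (rule u)
  finally have "norm (f j0) / a l j0 \<le> t * h j0" using h \<open>0 < t\<close> by simp
  moreover have "norm (f j0) = h j0 * a k j0" using pos[of k j0] by (simp add: h_def)
  ultimately have "a k j0 / a l j0 \<le> t" using h by (simp add: mult.commute[of t] flip: times_divide_eq_right)
  moreover have "a k n / a l n \<le> a k j0 / a l j0" using a \<open>k \<le> l\<close> j0 by (intro regular_ratio_antimono)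
  ultimately show ?thesis by linarith
qed

proposition kolmogorov_diameter_regular:
  fixes a :: "nat \<Rightarrow> nat \<Rightarrow> real"
  assumes a: "koethe_matrix a" "regular_matrix a" and "k \<le> l"
  defines "E \<equiv> koethe_space a :: (nat \<Rightarrow> 'a::real_normed_field) set"
  shows "kolmogorov_diameter E (unit_ball E (koethe_norm a) l) (unit_ball E (koethe_norm a) k) n = a k n / a l n"
proof -
  define S where "S = {t. 0 < t \<and> (\<exists>L. L \<subseteq> E \<and> seq.subspace L \<and> dim_at_most L n \<and>
    unit_ball E (koethe_norm a) l \<subseteq>
      {scale_seq (of_real t) u + z | u z. u \<in> unit_ball E (koethe_norm a) k \<and> z \<in> L})}"
  have "a k n / a l n \<in> S"
    unfolding S_def mem_Collect_eq
  proof
    show "0 < a k n / a l n" using regular_pos[OF a(2)] by simp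
  qed (use kolmogorov_diameter_le[OF a \<open>k \<le> l\<close>] in \<open>unfold E_def\<close>)
  moreover have "a k n / a l n \<le> t" if t: "t \<in> S" for t
  proof -
    from t obtain L where "0 < t" "dim_at_most L n" "unit_ball E (koethe_norm a) l \<subseteq>
      {scale_seq (of_real t) u + z | u z. u \<in> unit_ball E (koethe_norm a) k \<and> z \<in> L}"
      unfolding S_def mem_Collect_eq by (elim conjE exE)
    then show ?thesis unfolding E_def by (rule kolmogorov_diameter_ge[OF a \<open>k \<le> l\<close>])
  qed
  ultimately have "Inf S = a k n / a l n" by (rule cInf_eq_minimum)
  then show ?thesis by (simp only: kolmogorov_diameter_def S_def)
qed

corollary diametral_dimension_regular:
  assumes a: "koethe_matrix a" "regular_matrix a"
  shows "diametral_dimension (koethe_space a :: (nat \<Rightarrow> 'a::real_normed_field) set) (koethe_norm a) =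
    {t. \<forall>k. \<exists>l>k. (\<lambda>n. norm (t n) * (a k n / a l n)) \<longlonglongrightarrow> 0}"
proof -
  have "(\<lambda>n. t n * of_real (kolmogorov_diameter (koethe_space a :: (nat \<Rightarrow> 'a) set)
            (unit_ball (koethe_space a) (koethe_norm a) l) (unit_ball (koethe_space a) (koethe_norm a) k) n)) \<longlonglongrightarrow> 0
      \<longleftrightarrow> (\<lambda>n. norm (t n) * (a k n / a l n)) \<longlonglongrightarrow> 0" if "k < l" for k l and t :: "nat \<Rightarrow> 'a"
    using that regular_pos[OF a(2)]
    by (subst tendsto_norm_zero_iff[symmetric])
       (simp add: kolmogorov_diameter_regular[OF a] norm_mult norm_divide less_imp_le)
  then show ?thesis unfolding diametral_dimension_def by (intro Collect_cong) blast
qed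

section \<open>Nuclearity and the invariants\<close>

text \<open>
  The expansion into unit sequences is a nuclear representation.
\<close>

lemma nuclear_koetheI:
  fixes a :: "nat \<Rightarrow> nat \<Rightarrow> real"
  assumes a: "koethe_matrix a" and pos: "\<And>k n. 0 < a k n"
    and sum: "\<And>k. \<exists>l\<ge>k. summable (\<lambda>n. a k n / a l n)"
  shows "nuclear_space (koethe_space a :: (nat \<Rightarrow> 'a::real_normed_field) set) (koethe_norm a)"
  unfolding nuclear_space_def
proof
  fix k
  obtain l where l: "k \<le> l" "summable (\<lambda>n. a k n / a l n)" using sum by blast
  define E where "E = (koethe_space a :: (nat \<Rightarrow> 'a) set)"
  define f where "f = (\<lambda>j (x :: nat \<Rightarrow> 'a). x j)"
  have dual: "dual_norm E (koethe_norm a) l (f j) \<le> ennreal (1 / a l j)" for j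
    unfolding dual_norm_def
  proof (rule SUP_least)
    fix x assume "x \<in> unit_ball E (koethe_norm a) l"
    then have "norm (x j) * a l j \<le> 1"
      using koethe_norm_coordinate[OF a, of x j l] by (auto simp: unit_ball_def E_def)
    then show "ennreal (norm (f j x)) \<le> ennreal (1 / a l j)"
      using pos[of l j] by (intro ennreal_leI) (simp add: f_def pos_le_divide_eq)
  qed
  have "\<forall>j. linear_map_on E (*) (f j) \<and> dual_norm E (koethe_norm a) l (f j) < \<infinity> \<and> unit_seq j \<in> E"
    using le_less_trans[OF dual ennreal_less_top]
    by (auto simp: linear_map_on_def f_def scale_seq_def E_def unit_seq_in_koethe)
  moreover have "(\<Sum>j. dual_norm E (koethe_norm a) l (f j) * ennreal (koethe_norm a k (unit_seq j :: nat \<Rightarrow> 'a))) < \<infinity>"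
  proof -
    have "(\<Sum>j. dual_norm E (koethe_norm a) l (f j) * ennreal (koethe_norm a k (unit_seq j :: nat \<Rightarrow> 'a)))
        \<le> (\<Sum>j. ennreal (a k j / a l j))"
    proof (rule suminf_le)
      fix j
      have "ennreal (a k j / a l j) = ennreal (1 / a l j) * ennreal (a k j)"
        using pos[of l j] pos[of k j] by (simp flip: ennreal_mult')
      then show "dual_norm E (koethe_norm a) l (f j) * ennreal (koethe_norm a k (unit_seq j :: nat \<Rightarrow> 'a)) \<le> ennreal (a k j / a l j)"
        using dual[of j] by (simp add: koethe_norm_unit_seq mult_right_mono)
    qed auto
    also have "\<dots> < \<infinity>"
      using l(2) pos by (subst suminf_ennreal2) (auto intro: less_imp_le)
    finally show ?thesis .
  qed
  moreover have "(\<lambda>N. koethe_norm a k (x - (\<Sum>j<N. scale_seq (f j x) (unit_seq j)))) \<longlonglongrightarrow> 0" if "x \<in> E" for x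
    using koethe_norm_truncation_error[OF a, of x k] that by (simp add: f_def E_def truncate_eq_sum)
  ultimately show "\<exists>l\<ge>k. \<exists>f y.
        (\<forall>j. linear_map_on (koethe_space a :: (nat \<Rightarrow> 'a) set) (*) (f j) \<and> dual_norm (koethe_space a) (koethe_norm a) l (f j) < \<infinity> \<and> y j \<in> koethe_space a) \<and>
        (\<Sum>j. dual_norm (koethe_space a) (koethe_norm a) l (f j) * ennreal (koethe_norm a k (y j))) < \<infinity> \<and>
        (\<forall>x\<in>koethe_space a. (\<lambda>N. koethe_norm a k (x - (\<Sum>j<N. scale_seq (f j x) (y j)))) \<longlonglongrightarrow> 0)"
    using l(1) unfolding E_def by blast
qed

lemma koethe_norm_pos:
  assumes a: "koethe_matrix a" and pos: "\<And>n. 0 < a k n" and x: "x \<in> koethe_space a" "x n \<noteq> 0"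
  shows "0 < koethe_norm a k x"
proof -
  have "0 < norm (x n) * a k n" using pos[of n] x by simp
  with koethe_norm_coordinate[OF a x(1), of n k] show ?thesis by linarith
qed

text \<open>
  Hoelder's inequality in the form needed for \<open>DN\<close>: after normalising both seminorms on the right to 1,
  apply Young's inequality to each coordinate and sum.
\<close>

lemma koethe_norm_interpolation:
  fixes a :: "nat \<Rightarrow> nat \<Rightarrow> real" and x :: "nat \<Rightarrow> 'a::real_normed_field"
  assumes a: "koethe_matrix a" and pos: "\<And>k n. 0 < a k n" and "0 < C" "0 < \<theta>" "\<theta> < 1"
    and le: "\<And>n. a j n \<le> C * a k n powr \<theta> * a l n powr (1 - \<theta>)" and x: "x \<in> koethe_space a"
  shows "koethe_norm a j x \<le> C * koethe_norm a k x powr \<theta> * koethe_norm a l x powr (1 - \<theta>)"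
proof (cases "x = 0")
  case True
  then show ?thesis by (simp add: koethe_norm_zero[OF a])
next
  case False
  then obtain i where "x i \<noteq> 0" by (auto simp: fun_eq_iff)
  define A B where "A = koethe_norm a k x" and "B = koethe_norm a l x"
  have A: "0 < A" and B: "0 < B"
    unfolding A_def B_def using koethe_norm_pos[OF a pos x \<open>x i \<noteq> 0\<close>] by auto
  define D where "D = C * A powr \<theta> * B powr (1 - \<theta>)"
  have D: "0 < D" using A B \<open>0 < C\<close> by (simp add: D_def)
  have summand: "norm (x n) * a j n \<le> D * \<theta> / A * (norm (x n) * a k n) + D * (1 - \<theta>) / B * (norm (x n) * a l n)" for n
  proof (cases "x n = 0")
    case False
    define y where "y = norm (x n)"
    have y: "0 < y" using False by (simp add: y_def)
    have "y * a j n \<le> y * (C * a k n powr \<theta> * a l n powr (1 - \<theta>))" using le[of n] y by simp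
    also have "\<dots> = C * (y * a k n) powr \<theta> * (y * a l n) powr (1 - \<theta>)"
      using y pos[of k n] pos[of l n] by (simp add: powr_mult powr_diff)
    also have "\<dots> = D * ((y * a k n / A) powr \<theta> * (y * a l n / B) powr (1 - \<theta>))"
      using y A B pos[of k n] pos[of l n] by (simp add: D_def powr_divide)
    also have "\<dots> \<le> D * (\<theta> * (y * a k n / A) + (1 - \<theta>) * (y * a l n / B))"
      using y A B D pos[of k n] pos[of l n] assms(4,5) by (intro mult_left_mono Youngs_inequality_0) auto
    finally show ?thesis by (simp add: y_def algebra_simps)
  qed simp
  note s = koethe_spaceD[OF x]
  have "koethe_norm a j x \<le> (\<Sum>n. D * \<theta> / A * (norm (x n) * a k n) + D * (1 - \<theta>) / B * (norm (x n) * a l n))"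
    unfolding koethe_norm_def by (intro suminf_le summand summable_add summable_mult s)
  also have "\<dots> = D * \<theta> / A * A + D * (1 - \<theta>) / B * B"
    unfolding A_def B_def koethe_norm_def
    using suminf_add[OF summable_mult[OF s] summable_mult[OF s], symmetric] by (simp only: suminf_mult[OF s])
  also have "\<dots> = D * \<theta> + D * (1 - \<theta>)" using A B by simp
  also have "\<dots> = D" by (simp add: algebra_simps)
  finally show ?thesis by (simp add: D_def A_def B_def)
qed

text \<open>
  A continuous functional is determined by its values on the unit sequences, since the truncations of
  \<open>x\<close> converge to \<open>x\<close>. Thus the dual norm is the supremum of the quotients of these values by the
  matrix entries, and this lemma with the next one reduces \<open>\<Omega>\<close> to an inequality between matrix entries.
\<close>

lemma dual_space_bound:
  fixes f :: "(nat \<Rightarrow> 'a::real_normed_field) \<Rightarrow> 'a"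
  assumes a: "koethe_matrix a" and f: "f \<in> dual_space (koethe_space a) (koethe_norm a)"
    and D: "0 \<le> D" "\<And>n. norm (f (unit_seq n)) \<le> D * a q n"
  shows "dual_norm (koethe_space a) (koethe_norm a) q f \<le> ennreal D"
  unfolding dual_norm_def
proof (rule SUP_least)
  fix x :: "nat \<Rightarrow> 'a" assume "x \<in> unit_ball (koethe_space a) (koethe_norm a) q"
  then have x: "x \<in> koethe_space a" "koethe_norm a q x \<le> 1" by (auto simp: unit_ball_def)
  from f have add: "f (y + z) = f y + f z" if "y \<in> koethe_space a" "z \<in> koethe_space a" for y z
    using that by (auto simp: dual_space_def linear_map_on_def)
  from f have scale: "f (scale_seq c y) = c * f y" if "y \<in> koethe_space a" for c y
    using that by (auto simp: dual_space_def linear_map_on_def)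
  have trunc: "norm (f (truncate N x)) \<le> D" for N
  proof -
    have step: "truncate (Suc N) x = truncate N x + scale_seq (x N) (unit_seq N)" for N
      by (auto simp: truncate_def scale_seq_def unit_seq_def fun_eq_iff less_Suc_eq)
    have "scale_seq (x N) (unit_seq N) \<in> koethe_space a" for N
      using subspace_koethe_space[OF a] unit_seq_in_koethe by (rule seq.subspace_scale)
    then have suc: "f (truncate (Suc N) x) = f (truncate N x) + x N * f (unit_seq N)" for N
      unfolding step by (subst add) (auto simp: truncate_in_koethe scale[OF unit_seq_in_koethe])
    have "f (truncate 0 x) = 0"
      using scale[OF x(1), of 0] by (simp add: truncate_def scale_seq_def)
    then have "f (truncate N x) = (\<Sum>j<N. x j * f (unit_seq j))"
      by (induction N) (simp_all add: suc)
    also have "norm \<dots> \<le> (\<Sum>j<N. D * (norm (x j) * a q j))"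
    proof (rule sum_norm_le)
      fix j
      show "norm (x j * f (unit_seq j)) \<le> D * (norm (x j) * a q j)"
        using mult_left_mono[OF D(2)[of j] norm_ge_zero[of "x j"]] by (simp add: norm_mult mult_ac)
    qed
    also have "\<dots> = D * (\<Sum>j<N. norm (x j) * a q j)" by (simp add: sum_distrib_left)
    also have "(\<Sum>j<N. norm (x j) * a q j) \<le> koethe_norm a q x"
      unfolding koethe_norm_def
      by (intro sum_le_suminf koethe_spaceD x) (auto simp: koethe_nonneg[OF a])
    also have "koethe_norm a q x \<le> 1" by (rule x)
    finally show ?thesis using D by (simp add: mult_left_mono)
  qed
  have "norm (f x) \<le> D + e" if "0 < e" for e
  proof -
    have cont: "continuous_map (seminorm_topology (koethe_space a) (koethe_norm a)) euclidean f"
      using f by (simp add: dual_space_def)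
    have "openin (seminorm_topology (koethe_space a) (koethe_norm a))
        {y \<in> topspace (seminorm_topology (koethe_space a) (koethe_norm a)). f y \<in> ball (f x) e}"
      by (rule openin_continuous_map_preimage[OF cont]) simp
    moreover have "x \<in> {y \<in> topspace (seminorm_topology (koethe_space a) (koethe_norm a)). f y \<in> ball (f x) e}"
      using x \<open>0 < e\<close> by (simp add: topspace_seminorm_topology[OF a])
    ultimately obtain k r where r: "0 < r" "{y\<in>koethe_space a. koethe_norm a k (y - x) < r} \<subseteq>
        {y \<in> topspace (seminorm_topology (koethe_space a) (koethe_norm a)). f y \<in> ball (f x) e}"
      by (rule openin_koethe_contains_ball[OF a])
    obtain N where "koethe_norm a k (x - truncate N x) < r"
      using order_tendstoD(2)[OF koethe_norm_truncation_error[OF a x(1)] r(1)]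
      by (auto simp: eventually_sequentially)
    moreover have "koethe_norm a k (truncate N x - x) = koethe_norm a k (x - truncate N x)"
      by (simp add: koethe_norm_def norm_minus_commute)
    ultimately have "dist (f x) (f (truncate N x)) < e"
      using subsetD[OF r(2), of "truncate N x"] truncate_in_koethe[of N x a] by simp
    then have "norm (f x - f (truncate N x)) < e" by (simp add: dist_norm)
    with trunc[of N] norm_triangle_sub[of "f x" "f (truncate N x)"] show ?thesis by linarith
  qed
  then have "norm (f x) \<le> D" by (rule field_le_epsilon)
  then show "ennreal (norm (f x)) \<le> ennreal D" by (rule ennreal_leI)
qed

lemma dual_norm_unit_seq:
  assumes a: "koethe_matrix a" and pos: "0 < a k n"
    and f: "f \<in> dual_space (koethe_space a) (koethe_norm a)"
    and D: "dual_norm (koethe_space a) (koethe_norm a) k f = ennreal D" "0 \<le> D"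
  shows "norm (f (unit_seq n)) \<le> D * a k n"
proof -
  define x where "x = scale_seq (of_real (inverse (a k n))) (unit_seq n :: nat \<Rightarrow> 'a)"
  have "x \<in> unit_ball (koethe_space a) (koethe_norm a) k"
    unfolding x_def unit_ball_def
    using pos seq.subspace_scale[OF subspace_koethe_space[OF a] unit_seq_in_koethe]
    by (auto simp: koethe_norm_scale unit_seq_in_koethe koethe_norm_unit_seq norm_inverse)
  then have "ennreal (norm (f x)) \<le> ennreal D"
    unfolding D(1)[symmetric] dual_norm_def by (rule SUP_upper)
  moreover have "f x = of_real (inverse (a k n)) * f (unit_seq n)"
    using f by (simp add: x_def dual_space_def linear_map_on_def unit_seq_in_koethe)
  ultimately show ?thesis using pos D(2)
    by (simp add: norm_divide pos_divide_le_eq inverse_eq_divide)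
qed

lemma property_Omega_koetheI:
  fixes a :: "nat \<Rightarrow> nat \<Rightarrow> real"
  assumes a: "koethe_matrix a" and pos: "\<And>k n. 0 < a k n"
    and le: "\<And>m. \<exists>q. \<forall>k. \<exists>C \<theta>. 0 < C \<and> 0 < \<theta> \<and> \<theta> < 1 \<and>
      (\<forall>n. a m n powr (1 - \<theta>) * a k n powr \<theta> \<le> C * a q n)"
  shows "property_Omega (koethe_space a :: (nat \<Rightarrow> 'a::real_normed_field) set) (koethe_norm a)"
  unfolding property_Omega_def
proof
  fix m
  obtain q where q: "\<And>k. \<exists>C \<theta>. 0 < C \<and> 0 < \<theta> \<and> \<theta> < 1 \<and>
      (\<forall>n. a m n powr (1 - \<theta>) * a k n powr \<theta> \<le> C * a q n)" using le by blast
  define E where "E = (koethe_space a :: (nat \<Rightarrow> 'a) set)"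
  define p where "p = (koethe_norm a :: nat \<Rightarrow> (nat \<Rightarrow> 'a) \<Rightarrow> real)"
  have "\<exists>C \<theta>. 0 < C \<and> 0 < \<theta> \<and> \<theta> < 1 \<and> (\<forall>f\<in>dual_space E p. dual_norm E p q f \<le>
      ennreal C * ennreal_powr (dual_norm E p m f) (1 - \<theta>) * ennreal_powr (dual_norm E p k f) \<theta>)" for k
  proof -
    obtain C \<theta> where C: "0 < C" "0 < \<theta>" "\<theta> < 1"
      and le: "\<And>n. a m n powr (1 - \<theta>) * a k n powr \<theta> \<le> C * a q n" using q[of k] by blast
    have "dual_norm E p q f \<le> ennreal C * ennreal_powr (dual_norm E p m f) (1 - \<theta>) * ennreal_powr (dual_norm E p k f) \<theta>"
      if f: "f \<in> dual_space E p" for f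
    proof -
      note unit = dual_norm_unit_seq[OF a pos f[unfolded E_def p_def], folded E_def p_def]
      note bound = dual_space_bound[OF a f[unfolded E_def p_def], folded E_def p_def]
      have zero: "dual_norm E p q f = 0" if "dual_norm E p i f = 0" for i
      proof -
        have "norm (f (unit_seq n)) \<le> 0 * a q n" for n using unit[of i 0 n] that by simp
        from bound[OF _ this] show ?thesis by simp
      qed
      show ?thesis
      proof (cases "dual_norm E p m f = 0 \<or> dual_norm E p k f = 0")
        case True
        then show ?thesis using zero by (metis zero_le)
      next
        case nonzero: False
        show ?thesis
        proof (cases "dual_norm E p m f = \<infinity> \<or> dual_norm E p k f = \<infinity>")
          case True
          have "ennreal_powr t s \<noteq> 0" if "t \<noteq> 0" for t s
            using that by (cases t) (auto simp: ennreal_powr_def)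
          with True nonzero C(1) have "ennreal C * ennreal_powr (dual_norm E p m f) (1 - \<theta>) * ennreal_powr (dual_norm E p k f) \<theta> = \<infinity>"
            by (auto simp: ennreal_powr_def ennreal_mult_eq_top_iff ennreal_top_mult ennreal_mult_top)
          then show ?thesis by simp
        next
          case False
          then obtain A B where A: "dual_norm E p m f = ennreal A" "0 \<le> A" and B: "dual_norm E p k f = ennreal B" "0 \<le> B"
            by (metis ennreal_cases infinity_ennreal_def)
          define D where "D = C * A powr (1 - \<theta>) * B powr \<theta>"
          have "norm (f (unit_seq n)) \<le> D * a q n" for n
          proof -
            define y where "y = norm (f (unit_seq n))"
            have "y = y powr (1 - \<theta>) * y powr \<theta>" by (simp add: y_def flip: powr_add)
            also have "\<dots> \<le> (A * a m n) powr (1 - \<theta>) * (B * a k n) powr \<theta>"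
              unfolding y_def using unit[OF A] unit[OF B] C by (intro mult_mono powr_mono2) auto
            also have "\<dots> = A powr (1 - \<theta>) * B powr \<theta> * (a m n powr (1 - \<theta>) * a k n powr \<theta>)"
              using A B pos[of m n] pos[of k n] by (simp add: powr_mult)
            also have "\<dots> \<le> A powr (1 - \<theta>) * B powr \<theta> * (C * a q n)"
              by (intro mult_left_mono le) auto
            finally show ?thesis by (simp add: y_def D_def mult_ac)
          qed
          then have "dual_norm E p q f \<le> ennreal D" using C by (intro bound) (auto simp: D_def)
          also have "ennreal D = ennreal C * ennreal_powr (dual_norm E p m f) (1 - \<theta>) * ennreal_powr (dual_norm E p k f) \<theta>"
            using A B C by (simp add: ennreal_powr_def D_def ennreal_mult)
          finally show ?thesis .
        qed
      qed
    qed
    with C show ?thesis by blast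
  qed
  then show "\<exists>q. \<forall>k. \<exists>C \<theta>. 0 < C \<and> 0 < \<theta> \<and> \<theta> < 1 \<and> (\<forall>f\<in>dual_space (koethe_space a :: (nat \<Rightarrow> 'a) set) (koethe_norm a).
      dual_norm (koethe_space a) (koethe_norm a) q f \<le>
      ennreal C * ennreal_powr (dual_norm (koethe_space a) (koethe_norm a) m f) (1 - \<theta>) * ennreal_powr (dual_norm (koethe_space a) (koethe_norm a) k f) \<theta>)"
    unfolding E_def p_def by blast
qed

section \<open>Koethe spaces as subspaces\<close>

text \<open>
  Rescaling turns an implication between open conditions, which is what continuity and openness
  provide, into an inequality between seminorms. One of the two maps will be the identity: with
  \<open>S\<close> the identity this bounds \<open>T\<close>, and with \<open>T\<close> the identity it bounds the inverse of \<open>S\<close>.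
\<close>

lemma koethe_homogeneous_bound:
  fixes S T :: "(nat \<Rightarrow> 'a::real_normed_field) \<Rightarrow> nat \<Rightarrow> 'a"
  assumes b: "koethe_matrix b"
    and S: "\<And>x. x \<in> koethe_space b \<Longrightarrow> S x \<in> koethe_space a"
      "\<And>c x. x \<in> koethe_space b \<Longrightarrow> S (scale_seq c x) = scale_seq c (S x)"
    and T: "\<And>x. x \<in> koethe_space b \<Longrightarrow> T x \<in> koethe_space d"
      "\<And>c x. x \<in> koethe_space b \<Longrightarrow> T (scale_seq c x) = scale_seq c (T x)"
    and "0 < r"
    and lt: "\<And>x. x \<in> koethe_space b \<Longrightarrow> koethe_norm a k (S x) < r \<Longrightarrow> koethe_norm d l (T x) < 1"
    and x: "x \<in> koethe_space b" and pos: "0 < koethe_norm d l (T x)"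
  shows "r * koethe_norm d l (T x) \<le> koethe_norm a k (S x)"
proof (rule ccontr)
  assume less: "\<not> ?thesis"
  define t where "t = koethe_norm d l (T x)"
  define y where "y = scale_seq (of_real (inverse t)) x"
  have t: "0 < t" using pos by (simp add: t_def)
  have y: "y \<in> koethe_space b"
    unfolding y_def by (intro seq.subspace_scale subspace_koethe_space b x)
  have "koethe_norm a k (S y) = inverse t * koethe_norm a k (S x)"
    using S x t by (simp add: y_def koethe_norm_scale norm_inverse)
  also have "\<dots> < r" using less t by (simp add: t_def field_simps)
  finally have "koethe_norm d l (T y) < 1" by (rule lt[OF y])
  moreover have "koethe_norm d l (T y) = 1"
    using T x t by (simp add: y_def koethe_norm_scale norm_inverse t_def)
  ultimately show False by simp
qed

text \<open>
  The embedding \<open>T\<close> maps the span of the first \<open>n + 1\<close> unit sequences to \<open>E\<close>, so some nonzero \<open>x\<close> in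
  this span has an image whose first \<open>n\<close> coordinates vanish. By regularity, passing from seminorm
  \<open>q\<close> to seminorm \<open>p\<close> shrinks the image at least by the factor \<open>a p n / a q n\<close>, whereas passing from
  \<open>l\<close> to \<open>k\<close> shrinks \<open>x\<close> at most by \<open>b k n / b l n\<close>. In contrast to an inclusion of
  diametral dimensions, \<open>p\<close> serves all \<open>q\<close> and all \<open>n\<close> at once.
\<close>

lemma isomorphic_subspace_ratio_bound:
  fixes a b :: "nat \<Rightarrow> nat \<Rightarrow> real"
  assumes a: "koethe_matrix a" "regular_matrix a" and b: "koethe_matrix b" "regular_matrix b"
    and iso: "isomorphic_to_subspace (koethe_space b :: (nat \<Rightarrow> 'a::real_normed_field) set) (koethe_norm b)
        (koethe_space a) (koethe_norm a)"
  shows "\<exists>p. \<forall>q\<ge>p. \<exists>l\<ge>k. \<exists>C. \<forall>n. a q n / a p n \<le> C * (b l n / b k n)"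
proof -
  define G E where "G = (koethe_space b :: (nat \<Rightarrow> 'a) set)" and "E = (koethe_space a :: (nat \<Rightarrow> 'a) set)"
  define \<tau>G \<tau>E where "\<tau>G = seminorm_topology G (koethe_norm b)" and "\<tau>E = seminorm_topology E (koethe_norm a)"
  note topG = topspace_seminorm_topology[OF b(1), where 'a = 'a, folded G_def, folded \<tau>G_def]
  note topE = topspace_seminorm_topology[OF a(1), where 'a = 'a, folded E_def, folded \<tau>E_def]
  obtain F T where F: "F \<subseteq> E" and lin: "linear_map_on G scale_seq T"
    and T: "homeomorphic_map \<tau>G (subtopology \<tau>E F) T"
    using iso unfolding isomorphic_to_subspace_def G_def E_def \<tau>G_def \<tau>E_def by blast
  note subG = subspace_koethe_space[OF b(1), where 'a = 'a, folded G_def]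
  have add: "T (x + y) = T x + T y" if "x \<in> G" "y \<in> G" for x y
    using lin that by (simp add: linear_map_on_def)
  have scale: "T (scale_seq c x) = scale_seq c (T x)" if "x \<in> G" for c x
    using lin that by (simp add: linear_map_on_def)
  have img: "T x \<in> E" if "x \<in> G" for x
    using homeomorphic_imp_surjective_map[OF T] that F by (auto simp: topG topE)
  have inj: "inj_on T G"
    using homeomorphic_imp_injective_map[OF T] by (simp add: topG)
  have 0: "0 \<in> G" using subG by (rule seq.subspace_0)
  have T0: "T 0 = 0" using scale[OF 0, of 0] by simp
  have T_sum: "T (\<Sum>j\<in>A. g j) = (\<Sum>j\<in>A. T (g j))" if "finite A" "\<And>j. g j \<in> G" for A :: "nat set" and g
    using that(1)
  proof (induction A)
    case empty
    show ?case unfolding sum.empty by (rule T0)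
  next
    case (insert j A)
    have "(\<Sum>j\<in>A. g j) \<in> G" by (intro seq.subspace_sum subG that)
    then have "T (g j + (\<Sum>j\<in>A. g j)) = T (g j) + (\<Sum>j\<in>A. T (g j))"
      using insert.IH that by (simp only: add)
    then show ?case unfolding sum.insert[OF insert.hyps(1,2)] .
  qed
  note norm_nonneg = koethe_norm_nonneg[OF b(1), where 'a = 'a, folded G_def]
    koethe_norm_nonneg[OF a(1), where 'a = 'a, folded E_def]

  obtain p r where r: "0 < r" and lower: "\<And>x. x \<in> G \<Longrightarrow> r * koethe_norm b k x \<le> koethe_norm a p (T x)"
  proof -
    define U where "U = {x\<in>G. koethe_norm b k (x - 0) < 1}"
    have "openin \<tau>G U"
      unfolding U_def G_def \<tau>G_def by (rule openin_koethe_ball[OF b(1)]) (use 0 in \<open>auto simp: G_def\<close>)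
    then have "openin (subtopology \<tau>E F) (T ` U)"
      using homeomorphic_imp_open_map[OF T] by (simp add: open_map_def)
    then obtain W where W: "openin \<tau>E W" "T ` U = W \<inter> F" by (auto simp: openin_subtopology)
    have "0 \<in> U" using 0 by (simp add: U_def koethe_norm_zero[OF b(1)])
    then have "T 0 \<in> T ` U" by (rule imageI)
    then have "0 \<in> W" using W T0 by simp
    obtain p r where "0 < r" and W2: "{y\<in>E. koethe_norm a p (y - 0) < r} \<subseteq> W"
      using W(1) \<open>0 \<in> W\<close> unfolding \<tau>E_def E_def by (rule openin_koethe_contains_ball[OF a(1)])
    have lt: "koethe_norm b k x < 1" if x: "x \<in> G" "koethe_norm a p (T x) < r" for x
    proof -
      have "T x \<in> W" using W2 x img by auto
      moreover have "T x \<in> F"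
        using homeomorphic_imp_surjective_map[OF T] x by (auto simp: topG)
      ultimately obtain u where "u \<in> U" "T x = T u" using W(2) by blast
      then have "x = u" using inj x by (auto simp: inj_on_def U_def)
      then show ?thesis using \<open>u \<in> U\<close> by (simp add: U_def)
    qed
    have "r * koethe_norm b k x \<le> koethe_norm a p (T x)" if "x \<in> G" "0 < koethe_norm b k x" for x
      by (rule koethe_homogeneous_bound[OF b(1), of T a "\<lambda>x. x" b, folded G_def E_def];
          (rule scale img lt \<open>0 < r\<close> that refl | assumption)+)
    then have "r * koethe_norm b k x \<le> koethe_norm a p (T x)" if "x \<in> G" for x
      using that norm_nonneg(1)[of x k] norm_nonneg(2)[OF img, of x p]
      by (cases "koethe_norm b k x = 0") auto
    with \<open>0 < r\<close> show ?thesis by (rule that)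
  qed

  show ?thesis
  proof (rule exI[of _ p], intro allI impI)
    fix q assume "p \<le> q"
    obtain l0 s where s: "0 < s" and upper0: "\<And>x. x \<in> G \<Longrightarrow> s * koethe_norm a q (T x) \<le> koethe_norm b l0 x"
    proof -
      define W where "W = {y\<in>E. koethe_norm a q (y - 0) < 1}"
      have E0: "0 \<in> E" using img[OF 0] T0 by simp
      have "openin \<tau>E W"
        unfolding W_def E_def \<tau>E_def by (rule openin_koethe_ball[OF a(1)]) (use E0 in \<open>auto simp: E_def\<close>)
      moreover have "continuous_map \<tau>G \<tau>E T"
        using homeomorphic_imp_continuous_map[OF T] by (rule continuous_map_into_fulltopology)
      ultimately have pre: "openin \<tau>G {x \<in> G. T x \<in> W}"
        unfolding topG[symmetric] by (rule openin_continuous_map_preimage[rotated])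
      have in0: "0 \<in> {x \<in> G. T x \<in> W}" using 0 E0 T0 by (simp add: W_def koethe_norm_zero[OF a(1)])
      obtain l s where "0 < s" and sub: "{x\<in>G. koethe_norm b l (x - 0) < s} \<subseteq> {x \<in> G. T x \<in> W}"
        using pre in0 unfolding \<tau>G_def G_def by (rule openin_koethe_contains_ball[OF b(1)])
      have lt: "koethe_norm a q (T x) < 1" if "x \<in> G" "koethe_norm b l x < s" for x
        using sub that by (auto simp: W_def)
      have "s * koethe_norm a q (T x) \<le> koethe_norm b l x" if "x \<in> G" "0 < koethe_norm a q (T x)" for x
        by (rule koethe_homogeneous_bound[OF b(1), of "\<lambda>x. x" b T a, folded G_def E_def];
            (rule scale img lt \<open>0 < s\<close> that refl | assumption)+)
      then have "s * koethe_norm a q (T x) \<le> koethe_norm b l x" if "x \<in> G" for x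
        using that norm_nonneg(1)[of x l] norm_nonneg(2)[OF img, of x q]
        by (cases "koethe_norm a q (T x) = 0") auto
      with \<open>0 < s\<close> show ?thesis by (rule that)
    qed
    define l where "l = max k l0"
    have upper: "s * koethe_norm a q (T x) \<le> koethe_norm b l x" if "x \<in> G" for x
      using upper0[OF that] koethe_norm_mono[OF b(1), of x l0 l] that by (simp add: l_def G_def)
    have "a q n / a p n \<le> inverse (r * s) * (b l n / b k n)" for n
    proof -
      have "\<exists>x. (\<exists>j\<in>{..n}. x j \<noteq> 0) \<and> (\<forall>i\<in>{..<n}. (\<Sum>j\<in>{..n}. T (unit_seq j) i * x j) = 0)"
        by (rule homogeneous_system_nontrivial_solution) auto
      then obtain x0 j where j: "j \<le> n" "x0 j \<noteq> 0"
        and ker: "\<And>i. i < n \<Longrightarrow> (\<Sum>j\<le>n. T (unit_seq j) i * x0 j) = 0" by auto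
      define x where "x = truncate (Suc n) x0"
      have x: "x \<in> G" unfolding x_def G_def by (rule truncate_in_koethe)
      have unit: "unit_seq j \<in> G" for j unfolding G_def by (rule unit_seq_in_koethe)
      have "T x = (\<Sum>j\<le>n. scale_seq (x0 j) (T (unit_seq j)))"
      proof -
        have "scale_seq (x0 j) (unit_seq j) \<in> G" for j by (intro seq.subspace_scale subG unit)
        then show ?thesis
          unfolding x_def truncate_eq_sum lessThan_Suc_atMost by (simp add: T_sum scale unit)
      qed
      moreover have "(\<Sum>j\<in>A. scale_seq (x0 j) (T (unit_seq j))) i = (\<Sum>j\<in>A. T (unit_seq j) i * x0 j)" for A :: "nat set" and i
        by (induction A rule: infinite_finite_induct) (auto simp: scale_seq_def mult.commute)
      ultimately have Tx: "T x i = 0" if "i < n" for i using ker[OF that] by simp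
      have pos: "0 < koethe_norm b k x"
        using j x by (intro koethe_norm_pos[OF b(1) regular_pos[OF b(2)], of x j]) (auto simp: x_def truncate_def G_def)
      have low: "koethe_norm b l x \<le> b l n / b k n * koethe_norm b k x"
      proof -
        have "koethe_norm b l x \<le> (\<Sum>i<Suc n. b l n / b k n * (norm (x i) * b k i))"
        proof (subst koethe_norm_finite_support(2)[of "Suc n"])
          show "x i = 0" if "Suc n \<le> i" for i using that by (simp add: x_def truncate_def)
          show "(\<Sum>i<Suc n. norm (x i) * b l i) \<le> (\<Sum>i<Suc n. b l n / b k n * (norm (x i) * b k i))"
          proof (rule sum_mono)
            fix i assume "i \<in> {..<Suc n}"
            then have "b l i / b k i \<le> b l n / b k n"
              by (intro regular_ratio_mono[OF b(2)]) (auto simp: l_def)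
            then have "b l i \<le> b l n / b k n * b k i"
              using regular_pos[OF b(2), of k i] by (simp add: pos_divide_le_eq)
            from mult_left_mono[OF this norm_ge_zero[of "x i"]]
            show "norm (x i) * b l i \<le> b l n / b k n * (norm (x i) * b k i)" by (simp add: mult_ac)
          qed
        qed
        also have "\<dots> = b l n / b k n * koethe_norm b k x"
          by (subst koethe_norm_finite_support(2)[of "Suc n"]) (auto simp: x_def truncate_def sum_distrib_left simp del: sum.lessThan_Suc)
        finally show ?thesis .
      qed
      have tail: "koethe_norm a p (T x) \<le> a p n / a q n * koethe_norm a q (T x)"
        by (rule koethe_norm_tail_le) (use a \<open>p \<le> q\<close> img[OF x] Tx in \<open>auto simp: E_def\<close>)
      define A where "A = a q n / a p n"
      have A: "0 < A" using regular_pos[OF a(2)] by (simp add: A_def)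
      have "r * koethe_norm b k x * A * s \<le> b l n / b k n * koethe_norm b k x"
      proof -
        have "r * koethe_norm b k x * A \<le> koethe_norm a p (T x) * A"
          using lower[OF x] A by (intro mult_right_mono) auto
        also have "\<dots> \<le> (a p n / a q n * koethe_norm a q (T x)) * A"
          using tail A by (intro mult_right_mono) auto
        also have "\<dots> = koethe_norm a q (T x)"
          using regular_pos[OF a(2)] by (simp add: A_def less_imp_neq[symmetric])
        finally have "r * koethe_norm b k x * A * s \<le> koethe_norm a q (T x) * s"
          using s by (intro mult_right_mono) auto
        also have "\<dots> \<le> koethe_norm b l x" using upper[OF x] by (simp add: mult.commute)
        finally show ?thesis using low by linarith
      qed
      then have "r * s * A * koethe_norm b k x \<le> b l n / b k n * koethe_norm b k x"
        by (simp only: mult_ac)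
      then have "r * s * A \<le> b l n / b k n" using pos by (rule mult_right_le_imp_le)
      then have "inverse (r * s) * (r * s * A) \<le> inverse (r * s) * (b l n / b k n)"
        using r s by (intro mult_left_mono) auto
      moreover have "inverse (r * s) * (r * s * A) = A" using r s by (simp add: field_simps)
      ultimately show ?thesis by (simp only: A_def)
    qed
    then show "\<exists>l\<ge>k. \<exists>C. \<forall>n. a q n / a p n \<le> C * (b l n / b k n)"
      by (intro exI[of _ l]) (auto simp: l_def)
  qed
qed

section \<open>Sequences of subexponential growth and the associated exponent sequence\<close>

text \<open>
  This is \<open>\<Delta>(\<Lambda>\<^sub>1(\<beta>))\<close>, and it coincides with the set \<open>\<Lambda>\<^sub>1(\<beta>)\<close> in the nuclear case. Working
  with it avoids the seminorm indices.
\<close>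

definition subexponential :: "(nat \<Rightarrow> real) \<Rightarrow> (nat \<Rightarrow> 'a::real_normed_field) set" where
  "subexponential \<beta> = {t. \<forall>\<delta>>0. (\<lambda>n. norm (t n) * exp (- \<delta> * \<beta> n)) \<longlonglongrightarrow> 0}"

lemma subexponentialD: "t \<in> subexponential \<beta> \<Longrightarrow> 0 < \<delta> \<Longrightarrow> (\<lambda>n. norm (t n) * exp (- \<delta> * \<beta> n)) \<longlonglongrightarrow> 0"
  by (simp add: subexponential_def)

lemma exponent_sequence_nonneg: "exponent_sequence \<beta> \<Longrightarrow> 0 \<le> \<beta> n"
  by (simp add: exponent_sequence_def)

lemma tendsto_zero_norm_mult_le:
  fixes t :: "nat \<Rightarrow> 'a::real_normed_vector" and u v :: "nat \<Rightarrow> real"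
  assumes lim: "(\<lambda>n. norm (t n) * v n) \<longlonglongrightarrow> 0" and "\<And>n. 0 \<le> u n" "\<And>n. u n \<le> v n"
  shows "(\<lambda>n. norm (t n) * u n) \<longlonglongrightarrow> 0"
  by (rule tendsto_sandwich[OF _ _ tendsto_const lim]) (use assms in \<open>auto intro!: always_eventually mult_left_mono\<close>)

lemma power_series_matrix_1_koethe:
  assumes "exponent_sequence \<beta>"
  shows "koethe_matrix (power_series_matrix_1 \<beta>)" "regular_matrix (power_series_matrix_1 \<beta>)"
proof -
  note nonneg = exponent_sequence_nonneg[OF assms]
  have "\<beta> n / real (Suc (Suc k)) \<le> \<beta> n / real (Suc k)" for k n
    by (rule divide_left_mono) (auto simp: nonneg)
  then show "koethe_matrix (power_series_matrix_1 \<beta>)"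
    unfolding koethe_matrix_def power_series_matrix_1_def by auto
  have ratio: "power_series_matrix_1 \<beta> (Suc k) n / power_series_matrix_1 \<beta> k n = exp ((1 / real (Suc k) - 1 / real (Suc (Suc k))) * \<beta> n)" for k n
    unfolding power_series_matrix_1_def exp_diff[symmetric] by (simp add: algebra_simps)
  have "(1 / real (Suc k) - 1 / real (Suc (Suc k))) * \<beta> n \<le> (1 / real (Suc k) - 1 / real (Suc (Suc k))) * \<beta> (Suc n)" for k n
    using assms by (intro mult_left_mono) (auto simp: exponent_sequence_def mono_iff_le_Suc frac_le)
  then show "regular_matrix (power_series_matrix_1 \<beta>)"
    unfolding regular_matrix_def ratio by (auto simp: power_series_matrix_1_def)
qed

lemma power_series_matrix_inf_koethe:
  assumes "exponent_sequence \<beta>"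
  shows "koethe_matrix (power_series_matrix_inf \<beta>)" "regular_matrix (power_series_matrix_inf \<beta>)"
proof -
  show "koethe_matrix (power_series_matrix_inf \<beta>)"
    using exponent_sequence_nonneg[OF assms]
    unfolding koethe_matrix_def power_series_matrix_inf_def by (auto intro: mult_right_mono)
  have ratio: "power_series_matrix_inf \<beta> (Suc k) n / power_series_matrix_inf \<beta> k n = exp (\<beta> n)" for k n
    unfolding power_series_matrix_inf_def exp_diff[symmetric] by (simp add: algebra_simps)
  show "regular_matrix (power_series_matrix_inf \<beta>)"
    unfolding regular_matrix_def ratio
    using assms by (auto simp: power_series_matrix_inf_def exponent_sequence_def mono_iff_le_Suc)
qed

lemma diametral_dimension_Lambda_1:
  assumes \<beta>: "exponent_sequence \<beta>"
  shows "diametral_dimension (Lambda_1 \<beta> :: (nat \<Rightarrow> 'a::real_normed_field) set) (Lambda_1_norm \<beta>) = subexponential \<beta>"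
proof -
  note nonneg = exponent_sequence_nonneg[OF \<beta>]
  have ratio: "power_series_matrix_1 \<beta> k n / power_series_matrix_1 \<beta> l n = exp (- (1 / real (Suc k) - 1 / real (Suc l)) * \<beta> n)" for k l n
    unfolding power_series_matrix_1_def exp_diff[symmetric] by (simp add: algebra_simps)
  have "t \<in> subexponential \<beta>"
    if t: "\<forall>k. \<exists>l>k. (\<lambda>n. norm (t n) * exp (- (1 / real (Suc k) - 1 / real (Suc l)) * \<beta> n)) \<longlonglongrightarrow> 0"
    for t :: "nat \<Rightarrow> 'a"
    unfolding subexponential_def
  proof safe
    fix \<delta> :: real assume "0 < \<delta>"
    then obtain k where k: "1 / real (Suc k) < \<delta>" using nat_approx_posE by (metis inverse_eq_divide)
    obtain l where l: "(\<lambda>n. norm (t n) * exp (- (1 / real (Suc k) - 1 / real (Suc l)) * \<beta> n)) \<longlonglongrightarrow> 0"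
      using t by blast
    have "1 / real (Suc k) - 1 / real (Suc l) \<le> \<delta>" using k by (smt (verit) divide_nonneg_nonneg of_nat_0_le_iff)
    then have "- \<delta> * \<beta> n \<le> - (1 / real (Suc k) - 1 / real (Suc l)) * \<beta> n" for n
      by (intro mult_right_mono) (auto simp: nonneg)
    then show "(\<lambda>n. norm (t n) * exp (- \<delta> * \<beta> n)) \<longlonglongrightarrow> 0"
      by (intro tendsto_zero_norm_mult_le[OF l]) auto
  qed
  moreover have "\<exists>l>k. (\<lambda>n. norm (t n) * exp (- (1 / real (Suc k) - 1 / real (Suc l)) * \<beta> n)) \<longlonglongrightarrow> 0"
    if t: "t \<in> subexponential \<beta>" for k and t :: "nat \<Rightarrow> 'a"
    by (intro exI[of _ "Suc k"] conjI subexponentialD[OF t]) (auto simp: frac_less2)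
  ultimately show ?thesis
    unfolding diametral_dimension_regular[OF power_series_matrix_1_koethe[OF \<beta>]] ratio by blast
qed

lemma subexponential_subset_diametral_dimension_Lambda_inf:
  assumes \<beta>: "exponent_sequence \<beta>"
  shows "(subexponential \<beta> :: (nat \<Rightarrow> 'a::real_normed_field) set) \<subseteq> diametral_dimension (Lambda_inf \<beta>) (Lambda_inf_norm \<beta>)"
proof -
  have "power_series_matrix_inf \<beta> k n / power_series_matrix_inf \<beta> (Suc k) n = exp (- 1 * \<beta> n)" for k n
    unfolding power_series_matrix_inf_def exp_diff[symmetric] by (simp add: algebra_simps)
  then have "(\<lambda>n. norm (t n) * (power_series_matrix_inf \<beta> k n / power_series_matrix_inf \<beta> (Suc k) n)) \<longlonglongrightarrow> 0"
    if "t \<in> subexponential \<beta>" for t :: "nat \<Rightarrow> 'a" and k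
    using subexponentialD[OF that, of 1] by simp
  then show ?thesis
    unfolding diametral_dimension_regular[OF power_series_matrix_inf_koethe[OF \<beta>]] by blast
qed

lemma Lambda_1_subset_subexponential:
  assumes \<beta>: "exponent_sequence \<beta>"
  shows "(Lambda_1 \<beta> :: (nat \<Rightarrow> 'a::real_normed_field) set) \<subseteq> subexponential \<beta>"
proof
  fix t :: "nat \<Rightarrow> 'a" assume t: "t \<in> Lambda_1 \<beta>"
  show "t \<in> subexponential \<beta>"
    unfolding subexponential_def
  proof safe
    fix \<delta> :: real assume "0 < \<delta>"
    then obtain k where k: "1 / real (Suc k) < \<delta>" using nat_approx_posE by (metis inverse_eq_divide)
    have lim: "(\<lambda>n. norm (t n) * power_series_matrix_1 \<beta> k n) \<longlonglongrightarrow> 0"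
      by (intro summable_LIMSEQ_zero koethe_spaceD t)
    have "1 / real (Suc k) * \<beta> n \<le> \<delta> * \<beta> n" for n
      using k exponent_sequence_nonneg[OF \<beta>] by (intro mult_right_mono) auto
    then show "(\<lambda>n. norm (t n) * exp (- \<delta> * \<beta> n)) \<longlonglongrightarrow> 0"
      by (intro tendsto_zero_norm_mult_le[OF lim]) (auto simp: power_series_matrix_1_def)
  qed
qed

lemma subexponential_subset_Lambda_1:
  assumes sum: "\<And>\<delta>. 0 < \<delta> \<Longrightarrow> summable (\<lambda>n. exp (- \<delta> * \<beta> n))"
  shows "(subexponential \<beta> :: (nat \<Rightarrow> 'a::real_normed_field) set) \<subseteq> Lambda_1 \<beta>"
proof
  fix t :: "nat \<Rightarrow> 'a" assume t: "t \<in> subexponential \<beta>"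
  have "summable (\<lambda>n. norm (t n) * power_series_matrix_1 \<beta> k n)" for k
  proof -
    define \<delta> where "\<delta> = 1 / real (Suc k) / 2"
    have \<delta>: "0 < \<delta>" by (simp add: \<delta>_def)
    have "1 / real (Suc k) = \<delta> + \<delta>" by (simp only: \<delta>_def field_sum_of_halves)
    then have "- \<beta> n / real (Suc k) = - \<delta> * \<beta> n + - \<delta> * \<beta> n" for n
      by (simp only: divide_inverse mult_1) (simp only: algebra_simps)
    then have "power_series_matrix_1 \<beta> k n = exp (- \<delta> * \<beta> n) * exp (- \<delta> * \<beta> n)" for n
      unfolding power_series_matrix_1_def exp_add[symmetric] by (rule arg_cong)
    then have eq: "norm (t n) * power_series_matrix_1 \<beta> k n = norm (t n) * exp (- \<delta> * \<beta> n) * exp (- \<delta> * \<beta> n)" for n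
      by simp
    have "\<forall>\<^sub>F n in sequentially. norm (t n) * exp (- \<delta> * \<beta> n) < 1"
      using order_tendstoD(2)[OF subexponentialD[OF t \<delta>], of 1] by simp
    then have "\<forall>\<^sub>F n in sequentially. norm (norm (t n) * power_series_matrix_1 \<beta> k n) \<le> exp (- \<delta> * \<beta> n)"
      unfolding eq
    proof eventually_elim
      case (elim n)
      then have "norm (t n) * exp (- \<delta> * \<beta> n) * exp (- \<delta> * \<beta> n) \<le> 1 * exp (- \<delta> * \<beta> n)"
        by (intro mult_right_mono) auto
      then show ?case by simp
    qed
    then show ?thesis by (rule summable_comparison_test_ev[OF _ sum[OF \<delta>]])
  qed
  then show "t \<in> Lambda_1 \<beta>" by (simp add: koethe_space_def)
qed

lemma subexponential_subset_Lambda_inf_dual: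
  "(subexponential \<beta> :: (nat \<Rightarrow> 'a::real_normed_field) set) \<subseteq> Lambda_inf_dual \<beta>"
proof
  fix t :: "nat \<Rightarrow> 'a" assume "t \<in> subexponential \<beta>"
  then have "(\<lambda>n. norm (t n) * exp (- real 1 * \<beta> n)) \<longlonglongrightarrow> 0"
    using subexponentialD[of t \<beta> 1] by simp
  then have "Bseq (\<lambda>n. norm (t n) * exp (- real 1 * \<beta> n))"
    by (intro convergent_imp_Bseq convergentI)
  then have "bdd_above (range (\<lambda>n. norm (t n) * exp (- real 1 * \<beta> n)))"
    by (rule Bseq_bdd_above)
  then show "t \<in> Lambda_inf_dual \<beta>" unfolding Lambda_inf_dual_def by blast
qed

text \<open>
  If no bound holds, there are indices \<open>N j\<close> where \<open>\<beta>\<close> exceeds \<open>j\<^sup>2 * (\<alpha> + 1)\<close>. The sequence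
  that equals the exponential of the geometric mean of \<open>\<beta>\<close> and \<open>\<alpha> + 1\<close> at these indices and 0 elsewhere
  is subexponential for \<open>\<beta>\<close> and outgrows every \<open>exp (k * \<alpha>)\<close>. The shift by 1 takes care of indices
  with \<open>\<alpha> n = 0\<close>.
\<close>

lemma exponent_bound_of_subexponential_subset:
  assumes \<alpha>: "exponent_sequence \<alpha>" and \<beta>: "exponent_sequence \<beta>"
    and sub: "(subexponential \<beta> :: (nat \<Rightarrow> 'a::real_normed_field) set) \<subseteq> Lambda_inf_dual \<alpha>"
  shows "\<exists>M. \<forall>n. \<beta> n \<le> M * (\<alpha> n + 1)"
proof (rule ccontr)
  assume "\<not> ?thesis"
  then have "\<forall>j::nat. \<exists>n. (real j)\<^sup>2 * (\<alpha> n + 1) < \<beta> n" by (meson not_le)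
  then obtain N :: "nat \<Rightarrow> nat" where N: "\<And>j. (real j)\<^sup>2 * (\<alpha> (N j) + 1) < \<beta> (N j)" by metis
  have \<alpha>_pos: "0 < \<alpha> n + 1" for n using exponent_sequence_nonneg[OF \<alpha>, of n] by simp
  note \<beta>_nonneg = exponent_sequence_nonneg[OF \<beta>]
  define g where "g = (\<lambda>n. sqrt (\<beta> n * (\<alpha> n + 1)))"
  define t :: "nat \<Rightarrow> 'a" where "t = (\<lambda>n. if n \<in> range N then of_real (exp (g n)) else 0)"
  have "t \<in> subexponential \<beta>"
    unfolding subexponential_def
  proof safe
    fix \<delta> :: real assume \<delta>: "0 < \<delta>"
    obtain J :: nat where J: "2 / \<delta> \<le> real J" using real_arch_simple by blast
    have small: "g (N j) \<le> \<delta> / 2 * \<beta> (N j)" if "J \<le> j" for j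
    proof -
      have "2 / \<delta> \<le> real j" using J that by linarith
      then have "(2 / \<delta>)\<^sup>2 \<le> (real j)\<^sup>2" using \<delta> by (intro power_mono) auto
      then have "(2 / \<delta>)\<^sup>2 * (\<alpha> (N j) + 1) \<le> (real j)\<^sup>2 * (\<alpha> (N j) + 1)"
        using \<alpha>_pos by (intro mult_right_mono) (auto intro: less_imp_le)
      with N[of j] have "(2 / \<delta>)\<^sup>2 * (\<alpha> (N j) + 1) \<le> \<beta> (N j)" by linarith
      then have "(\<delta> / 2)\<^sup>2 * ((2 / \<delta>)\<^sup>2 * (\<alpha> (N j) + 1)) \<le> (\<delta> / 2)\<^sup>2 * \<beta> (N j)"
        by (intro mult_left_mono) auto
      then have "\<alpha> (N j) + 1 \<le> (\<delta> / 2)\<^sup>2 * \<beta> (N j)"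
        using \<delta> by (simp add: power_divide)
      then have "\<beta> (N j) * (\<alpha> (N j) + 1) \<le> \<beta> (N j) * ((\<delta> / 2)\<^sup>2 * \<beta> (N j))"
        using \<beta>_nonneg by (intro mult_left_mono) auto
      also have "\<dots> = (\<delta> / 2 * \<beta> (N j))\<^sup>2" by (simp add: power2_eq_square algebra_simps)
      finally show ?thesis
        unfolding g_def using \<delta> \<beta>_nonneg[of "N j"] by (intro real_le_lsqrt) auto
    qed
    have "\<forall>\<^sub>F n in sequentially. n \<notin> N ` {..<J}"
      using eventually_cofinite[of "\<lambda>n. n \<notin> N ` {..<J}"] by (simp add: cofinite_eq_sequentially)
    then have bound: "\<forall>\<^sub>F n in sequentially. norm (t n) * exp (- \<delta> * \<beta> n) \<le> exp (- (\<delta> / 2 * \<beta> n))"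
    proof eventually_elim
      case (elim n)
      show ?case
      proof (cases "n \<in> range N")
        case True
        then obtain j where j: "n = N j" by blast
        with elim have "J \<le> j" by (meson image_eqI lessThan_iff not_le)
        from small[OF this] have "exp (g n) * exp (- \<delta> * \<beta> n) \<le> exp (- (\<delta> / 2 * \<beta> n))"
          by (simp add: j flip: exp_add)
        then show ?thesis using True by (simp add: t_def)
      qed (simp add: t_def)
    qed
    have "filterlim (\<lambda>n. \<delta> / 2 * \<beta> n) at_top sequentially"
      using \<beta> \<delta> by (intro filterlim_tendsto_pos_mult_at_top[OF tendsto_const]) (auto simp: exponent_sequence_def)
    then have lim: "(\<lambda>n. exp (- (\<delta> / 2 * \<beta> n))) \<longlonglongrightarrow> 0"
      by (intro filterlim_compose[OF exp_at_bot]) (simp add: filterlim_uminus_at_bot)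
    show "(\<lambda>n. norm (t n) * exp (- \<delta> * \<beta> n)) \<longlonglongrightarrow> 0"
      by (rule tendsto_sandwich[OF _ bound tendsto_const lim]) auto
  qed
  with sub have "t \<in> Lambda_inf_dual \<alpha>" by blast
  then obtain k B where B: "\<And>n. norm (t n) * exp (- real k * \<alpha> n) \<le> B"
    unfolding Lambda_inf_dual_def bdd_above_def by auto
  define j where "j = max k (nat \<lceil>B\<rceil>)"
  have "real j * (\<alpha> (N j) + 1) \<le> g (N j)"
    unfolding g_def
  proof (rule real_le_rsqrt)
    have "(real j * (\<alpha> (N j) + 1))\<^sup>2 = ((real j)\<^sup>2 * (\<alpha> (N j) + 1)) * (\<alpha> (N j) + 1)"
      by (simp add: power2_eq_square)
    also have "\<dots> \<le> \<beta> (N j) * (\<alpha> (N j) + 1)"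
      using N[of j] \<alpha>_pos[of "N j"] by (intro mult_right_mono) auto
    finally show "(real j * (\<alpha> (N j) + 1))\<^sup>2 \<le> \<beta> (N j) * (\<alpha> (N j) + 1)" .
  qed
  moreover have "real k * \<alpha> (N j) \<le> real j * \<alpha> (N j)"
    using exponent_sequence_nonneg[OF \<alpha>] by (intro mult_right_mono) (auto simp: j_def)
  ultimately have "real j \<le> g (N j) - real k * \<alpha> (N j)" by (simp add: algebra_simps)
  then have "exp (real j) \<le> exp (g (N j)) * exp (- real k * \<alpha> (N j))"
    by (simp flip: exp_add)
  also have "\<dots> \<le> B" using B[of "N j"] by (simp add: t_def)
  also have "B \<le> real j" unfolding j_def by linarith
  finally show False using exp_ge_add_one_self[of "real j"] by linarith
qed

lemma Lambda_inf_dual_mono: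
  assumes "exponent_sequence \<alpha>" and le: "\<And>n. \<beta> n \<le> M * (\<alpha> n + 1)"
  shows "(Lambda_inf_dual \<beta> :: (nat \<Rightarrow> 'a::real_normed_field) set) \<subseteq> Lambda_inf_dual \<alpha>"
proof
  fix t :: "nat \<Rightarrow> 'a" assume "t \<in> Lambda_inf_dual \<beta>"
  then obtain k B where B: "\<And>n. norm (t n) * exp (- real k * \<beta> n) \<le> B"
    unfolding Lambda_inf_dual_def bdd_above_def by auto
  obtain m :: nat where m: "real k * M \<le> real m" using real_arch_simple by blast
  have "norm (t n) * exp (- real m * \<alpha> n) \<le> B * exp (real m)" for n
  proof -
    have "real k * \<beta> n \<le> real k * (M * (\<alpha> n + 1))" by (intro mult_left_mono le) auto
    also have "\<dots> \<le> real m * (\<alpha> n + 1)"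
      using m exponent_sequence_nonneg[OF assms(1), of n] by (simp add: mult_right_mono flip: mult.assoc)
    finally have "exp (- real m * \<alpha> n) \<le> exp (- real k * \<beta> n) * exp (real m)"
      by (simp add: algebra_simps flip: exp_add)
    then have "norm (t n) * exp (- real m * \<alpha> n) \<le> norm (t n) * (exp (- real k * \<beta> n) * exp (real m))"
      by (rule mult_left_mono) simp
    also have "\<dots> \<le> B * exp (real m)" using B[of n] by (simp add: mult_right_mono flip: mult.assoc)
    finally show ?thesis .
  qed
  then show "t \<in> Lambda_inf_dual \<alpha>" unfolding Lambda_inf_dual_def bdd_above_def by blast
qed

lemma associated_exponent_sequence_subexponential:
  fixes E :: "(nat \<Rightarrow> 'a::real_normed_field) set"
  assumes \<epsilon>: "exponent_sequence \<epsilon>" and sum: "\<And>\<delta>. 0 < \<delta> \<Longrightarrow> summable (\<lambda>n. exp (- \<delta> * \<epsilon> n))"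
    and E: "diametral_dimension E p = subexponential \<epsilon>"
  shows "associated_exponent_sequence E p \<epsilon>"
  unfolding associated_exponent_sequence_def E diametral_dimension_Lambda_1[OF \<epsilon>]
  using \<epsilon> subexponential_subset_diametral_dimension_Lambda_inf[OF \<epsilon>, where 'a = 'a]
    subexponential_subset_Lambda_1[OF sum, where 'a = 'a]
    exponent_bound_of_subexponential_subset[OF _ \<epsilon>, where 'a = 'a]
    Lambda_inf_dual_mono[where 'a = 'a]
  by (meson order_refl order_trans)

text \<open>
  The extremal property of \<open>\<gamma>\<close> among finite type spaces, applied to \<open>\<epsilon>\<close> itself, shows that \<open>\<gamma>\<close>
  and \<open>\<epsilon>\<close> have the same subexponential sequences. The domination of \<open>\<gamma>\<close> is then read off from them.
\<close>

lemma associated_exponent_sequence_unique: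
  fixes E :: "(nat \<Rightarrow> 'a::real_normed_field) set"
  assumes \<epsilon>: "exponent_sequence \<epsilon>" and sum: "\<And>\<delta>. 0 < \<delta> \<Longrightarrow> summable (\<lambda>n. exp (- \<delta> * \<epsilon> n))"
    and E: "diametral_dimension E p = subexponential \<epsilon>"
    and assoc: "associated_exponent_sequence E p \<gamma>"
  shows "exponent_sequence \<gamma>"
    and "diametral_dimension E p = diametral_dimension (Lambda_1 \<gamma>) (Lambda_1_norm \<gamma>)"
    and "\<exists>M. \<forall>n. \<gamma> n \<le> M * (\<epsilon> n + 1)"
proof -
  show \<gamma>: "exponent_sequence \<gamma>" using assoc by (simp add: associated_exponent_sequence_def)
  have "(subexponential \<epsilon> :: (nat \<Rightarrow> 'a) set) \<subseteq> Lambda_1 \<epsilon>" by (rule subexponential_subset_Lambda_1[OF sum])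
  also have "(Lambda_1 \<epsilon> :: (nat \<Rightarrow> 'a) set) \<subseteq> Lambda_1 \<gamma>"
    using assoc Lambda_1_subset_subexponential[OF \<epsilon>, where 'a = 'a] \<epsilon>
    by (simp add: associated_exponent_sequence_def E)
  also have "(Lambda_1 \<gamma> :: (nat \<Rightarrow> 'a) set) \<subseteq> subexponential \<gamma>" by (rule Lambda_1_subset_subexponential[OF \<gamma>])
  finally have eq: "(subexponential \<epsilon> :: (nat \<Rightarrow> 'a) set) = subexponential \<gamma>"
    using assoc by (auto simp: associated_exponent_sequence_def E diametral_dimension_Lambda_1[OF \<gamma>])
  show "diametral_dimension E p = diametral_dimension (Lambda_1 \<gamma>) (Lambda_1_norm \<gamma>)"
    by (simp only: E eq diametral_dimension_Lambda_1[OF \<gamma>])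
  show "\<exists>M. \<forall>n. \<gamma> n \<le> M * (\<epsilon> n + 1)"
    using exponent_bound_of_subexponential_subset[OF \<epsilon> \<gamma>, where 'a = 'a]
      subexponential_subset_Lambda_inf_dual[of \<epsilon>, where 'a = 'a] eq by simp
qed

section \<open>A Koethe space with unbounded jumps\<close>

text \<open>
  Any function with \<open>jump n \<le> n\<close> and infinite fibres would serve.
\<close>

definition jump :: "nat \<Rightarrow> nat" where
  "jump n = fst (prod_decode n)"

text \<open>
  The quotient \<open>expo (n + 1) / expo n = (n + 1)\<^sup>3\<close> has to compensate for a jump of height \<open>k \<le> n\<close>
  against the gap \<open>1 / ((k + 1) * (k + 2))\<close> of the next column, i.e. to dominate
  \<open>1 + k * (k + 1) * (k + 2)\<close>.
\<close>

definition expo :: "nat \<Rightarrow> real" where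
  "expo n = fact n ^ 3"

definition slope :: "nat \<Rightarrow> nat \<Rightarrow> real" where
  "slope k n = (if jump n < k then real (jump n) else 0) - 1 / real (Suc k)"

definition jump_matrix :: "nat \<Rightarrow> nat \<Rightarrow> real" where
  "jump_matrix k n = exp (expo n * slope k n)"

lemma jump_le: "jump n \<le> n"
  using le_prod_encode_1[of "fst (prod_decode n)" "snd (prod_decode n)"] by (simp add: jump_def)

lemma jump_prod_encode: "jump (prod_encode (m, i)) = m"
  by (simp add: jump_def)

lemma expo_ge: "real n \<le> expo n" "1 \<le> expo n"
proof -
  have "real n \<le> fact n" using fact_ge_self[of n] by (metis of_nat_fact of_nat_le_iff)
  moreover have "(1::real) \<le> fact n" by (rule fact_ge_1)
  moreover from this have "(fact n :: real) ^ 1 \<le> fact n ^ 3" by (intro power_increasing) auto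
  ultimately show "real n \<le> expo n" "1 \<le> expo n" by (auto simp: expo_def)
qed

lemma expo_Suc: "expo (Suc n) = real (Suc n) ^ 3 * expo n"
  by (simp add: expo_def power_mult_distrib del: of_nat_Suc)

lemma exponent_sequence_expo: "exponent_sequence expo"
proof -
  have "expo n \<le> expo (Suc n)" for n
  proof -
    have "1 * expo n \<le> real (Suc n) ^ 3 * expo n"
      using expo_ge(2)[of n] by (intro mult_right_mono one_le_power) auto
    then show ?thesis by (simp add: expo_Suc)
  qed
  moreover have "0 \<le> expo n" for n using expo_ge(2)[of n] by linarith
  moreover have "filterlim expo at_top sequentially"
    by (rule filterlim_at_top_mono[OF filterlim_real_sequentially]) (simp add: expo_ge always_eventually)
  ultimately show ?thesis by (simp add: exponent_sequence_def mono_iff_le_Suc)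
qed

lemma summable_exp_expo:
  assumes "0 < \<delta>"
  shows "summable (\<lambda>n. exp (- \<delta> * expo n))"
proof (rule summable_comparison_test_ev)
  show "summable (\<lambda>n. exp (- \<delta>) ^ n)" using assms by (intro summable_geometric) simp
  have "exp (- \<delta> * expo n) \<le> exp (- \<delta>) ^ n" for n
    using assms expo_ge(1)[of n] by (simp add: mult.commute flip: exp_of_nat_mult)
  then show "\<forall>\<^sub>F n in sequentially. norm (exp (- \<delta> * expo n)) \<le> exp (- \<delta>) ^ n" by simp
qed

definition gap :: "nat \<Rightarrow> real" where
  "gap k = 1 / real (Suc k) - 1 / real (Suc (Suc k))"

lemma gap_pos: "0 < gap k"
  by (simp add: gap_def frac_less2)

lemma gap_eq: "gap k = 1 / ((real k + 1) * (real k + 2))"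
  by (simp add: gap_def field_simps)

lemma slope_Suc: "slope (Suc k) n = slope k n + gap k + (if jump n = k then real k else 0)"
  by (auto simp: slope_def gap_def)

lemma slope_bounds: "- 1 \<le> slope k n" "slope k n \<le> real k"
proof -
  have "1 / real (Suc k) \<le> 1" "0 \<le> 1 / real (Suc k)" by simp_all
  then show "- 1 \<le> slope k n" "slope k n \<le> real k"
    unfolding slope_def by (cases "jump n < k"; simp only: if_True if_False; linarith)+
qed

text \<open>
  A step that does not contain the jump of column \<open>n\<close> looks like a step in \<open>\<Lambda>\<^sub>1(expo)\<close>.
\<close>

lemma slope_diff_le:
  assumes "k \<le> l" "\<not> (k \<le> jump n \<and> jump n < l)"
  shows "slope l n - slope k n \<le> 1 / real (Suc k)"
  using assms by (auto simp: slope_def)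

lemma jump_matrix_ratio: "jump_matrix k n / jump_matrix l n = exp (- (slope l n - slope k n) * expo n)"
  by (simp add: jump_matrix_def algebra_simps flip: exp_diff)

lemma koethe_jump_matrix: "koethe_matrix jump_matrix"
proof -
  have "expo n * slope k n \<le> expo n * slope (Suc k) n" for k n
    using expo_ge(2)[of n] gap_pos[of k] by (intro mult_left_mono) (auto simp: slope_Suc)
  then show ?thesis by (auto simp: koethe_matrix_def jump_matrix_def)
qed

text \<open>
  The only critical case is a jump at column \<open>n\<close> between the seminorms \<open>k\<close> and \<open>k + 1\<close> that is followed
  by a column without a jump there. Then \<open>k = jump n \<le> n\<close>, so the growth of \<open>expo\<close> is sufficient.
\<close>

lemma regular_jump_matrix: "regular_matrix jump_matrix"
proof -
  have "expo n * (slope (Suc k) n - slope k n) \<le> expo (Suc n) * (slope (Suc k) (Suc n) - slope k (Suc n))" for k n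
  proof -
    have "expo n * (slope (Suc k) n - slope k n) \<le> expo (Suc n) * gap k"
    proof (cases "jump n = k")
      case True
      then have "k \<le> n" using jump_le by blast
      define y where "y = real k"
      have y: "0 \<le> y" by (simp add: y_def)
      have "gap k * ((y + 1) * (y + 2)) = 1" using y unfolding gap_eq y_def[symmetric] by simp
      moreover have "gap k * (1 + y * (y + 1) * (y + 2)) = gap k + y * (gap k * ((y + 1) * (y + 2)))"
        by (simp add: algebra_simps)
      ultimately have "gap k + y = gap k * (1 + y * (y + 1) * (y + 2))" by (simp only: mult_1_right)
      also have "\<dots> \<le> gap k * (y + 1) ^ 3"
      proof (rule mult_left_mono)
        have "(y + 1) ^ 3 = 1 + y * (y + 1) * (y + 2) + y"
          by (simp add: power3_eq_cube power2_eq_square algebra_simps)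
        then show "1 + y * (y + 1) * (y + 2) \<le> (y + 1) ^ 3" using y by simp
      qed (use gap_pos[of k] in simp)
      also have "\<dots> \<le> gap k * real (Suc n) ^ 3"
        using \<open>k \<le> n\<close> gap_pos[of k] by (intro mult_left_mono power_mono) (auto simp: y_def)
      finally have "expo n * (gap k + y) \<le> expo n * (gap k * real (Suc n) ^ 3)"
        using expo_ge(2)[of n] by (intro mult_left_mono) auto
      then show ?thesis using True by (simp add: slope_Suc expo_Suc y_def mult_ac)
    next
      case False
      have "expo n * gap k \<le> expo (Suc n) * gap k"
        using exponent_sequence_expo gap_pos[of k]
        by (intro mult_right_mono) (auto simp: exponent_sequence_def mono_iff_le_Suc)
      then show ?thesis using False by (simp add: slope_Suc)
    qed
    also have "\<dots> \<le> expo (Suc n) * (slope (Suc k) (Suc n) - slope k (Suc n))"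
      using expo_ge(2)[of "Suc n"] by (intro mult_left_mono) (auto simp: slope_Suc)
    finally show ?thesis .
  qed
  then show ?thesis
    by (auto simp: regular_matrix_def jump_matrix_def right_diff_distrib simp flip: exp_diff)
qed

lemma nuclear_jump_space: "nuclear_space (koethe_space jump_matrix :: (nat \<Rightarrow> 'a::real_normed_field) set) (koethe_norm jump_matrix)"
proof (rule nuclear_koetheI[OF koethe_jump_matrix regular_pos[OF regular_jump_matrix]])
  fix k
  have "summable (\<lambda>n. jump_matrix k n / jump_matrix (Suc k) n)"
  proof (rule summable_comparison_test_ev)
    show "summable (\<lambda>n. exp (- gap k * expo n))" by (rule summable_exp_expo[OF gap_pos])
    have "gap k * expo n \<le> (slope (Suc k) n - slope k n) * expo n" for n
      using expo_ge(2)[of n] by (intro mult_right_mono) (auto simp: slope_Suc)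
    then show "\<forall>\<^sub>F n in sequentially. norm (jump_matrix k n / jump_matrix (Suc k) n) \<le> exp (- gap k * expo n)"
      unfolding jump_matrix_ratio
      by (simp only: real_norm_def abs_exp_cancel exp_le_cancel_iff mult_minus_left neg_le_iff_le eventually_True simp_thms)
  qed
  then show "\<exists>l\<ge>k. summable (\<lambda>n. jump_matrix k n / jump_matrix l n)" by (intro exI[of _ "Suc k"]) simp
qed

lemma jump_matrix_powr: "jump_matrix k n powr \<theta> = exp (expo n * (\<theta> * slope k n))"
  by (simp add: jump_matrix_def powr_def)

lemma DN_underlined_jump_space:
  "property_DN_underlined (koethe_space jump_matrix :: (nat \<Rightarrow> 'a::real_normed_field) set) (koethe_norm jump_matrix)"
  unfolding property_DN_underlined_def
proof (rule exI[of _ 0], rule allI)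
  fix j
  \<comment> \<open>\<open>slope (Suc j) n - slope 0 n \<le> j + 2\<close>, and one step gains at least \<open>gap j\<close>\<close>
  define \<theta> where "\<theta> = gap j / (real j + 2)"
  have \<theta>: "0 < \<theta>" using gap_pos[of j] by (simp add: \<theta>_def)
  have "gap j < 1"
  proof -
    have "1 / real (Suc j) \<le> 1" "0 < 1 / real (Suc (Suc j))" by simp_all
    then show ?thesis unfolding gap_def by linarith
  qed
  then have \<theta>1: "\<theta> < 1" by (simp add: \<theta>_def)
  have "slope j n \<le> \<theta> * slope 0 n + (1 - \<theta>) * slope (Suc j) n" for n
  proof -
    have "\<theta> * (slope (Suc j) n + 1) \<le> \<theta> * (real j + 2)"
      using \<theta> slope_bounds(2)[of "Suc j" n] by (intro mult_left_mono) auto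
    also have "\<dots> = gap j" by (simp add: \<theta>_def)
    also have "\<dots> \<le> slope (Suc j) n - slope j n" by (simp add: slope_Suc)
    finally show ?thesis by (simp add: slope_def[of 0] algebra_simps)
  qed
  then have "expo n * slope j n \<le> expo n * (\<theta> * slope 0 n + (1 - \<theta>) * slope (Suc j) n)" for n
    using expo_ge(2)[of n] by (intro mult_left_mono) auto
  then have "jump_matrix j n \<le> 1 * jump_matrix 0 n powr \<theta> * jump_matrix (Suc j) n powr (1 - \<theta>)" for n
    unfolding jump_matrix_powr by (simp add: jump_matrix_def distrib_left flip: exp_add)
  from koethe_norm_interpolation[OF koethe_jump_matrix regular_pos[OF regular_jump_matrix] zero_less_one \<theta> \<theta>1 this]
  show "\<exists>l C \<theta>. 0 < C \<and> 0 < \<theta> \<and> \<theta> < 1 \<and> (\<forall>x\<in>(koethe_space jump_matrix :: (nat \<Rightarrow> 'a) set).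
      koethe_norm jump_matrix j x \<le> C * koethe_norm jump_matrix 0 x powr \<theta> * koethe_norm jump_matrix l x powr (1 - \<theta>))"
    using \<theta> \<theta>1 zero_less_one[where 'a = real] by blast
qed

lemma Omega_jump_space:
  "property_Omega (koethe_space jump_matrix :: (nat \<Rightarrow> 'a::real_normed_field) set) (koethe_norm jump_matrix)"
proof (rule property_Omega_koetheI[OF koethe_jump_matrix regular_pos[OF regular_jump_matrix]])
  fix m
  have "\<exists>C \<theta>. 0 < C \<and> 0 < \<theta> \<and> \<theta> < 1 \<and>
      (\<forall>n. jump_matrix m n powr (1 - \<theta>) * jump_matrix k n powr \<theta> \<le> C * jump_matrix (Suc m) n)" for k
  proof -
    \<comment> \<open>\<open>slope k n - slope m n \<le> k + 1\<close>; the summand \<open>gap m\<close> makes \<open>\<theta> < 1\<close>\<close>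
    define \<theta> where "\<theta> = gap m / (real k + 1 + gap m)"
    have \<theta>: "0 < \<theta>" "\<theta> < 1" using gap_pos[of m] by (auto simp: \<theta>_def divide_simps)
    have "(1 - \<theta>) * slope m n + \<theta> * slope k n \<le> slope (Suc m) n" for n
    proof -
      have "\<theta> * (slope k n - slope m n) \<le> \<theta> * (real k + 1 + gap m)"
        using \<theta> slope_bounds(2)[of k n] slope_bounds(1)[of m n] gap_pos[of m] by (intro mult_left_mono) auto
      also have "\<dots> = gap m" using gap_pos[of m] by (simp add: \<theta>_def)
      also have "\<dots> \<le> slope (Suc m) n - slope m n" by (simp add: slope_Suc)
      finally show ?thesis by (simp add: algebra_simps)
    qed
    then have "expo n * ((1 - \<theta>) * slope m n + \<theta> * slope k n) \<le> expo n * slope (Suc m) n" for n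
      using expo_ge(2)[of n] by (intro mult_left_mono) auto
    then have "jump_matrix m n powr (1 - \<theta>) * jump_matrix k n powr \<theta> \<le> 1 * jump_matrix (Suc m) n" for n
      unfolding jump_matrix_powr by (simp add: jump_matrix_def distrib_left flip: exp_add)
    with \<theta> show ?thesis using zero_less_one[where 'a = real] by blast
  qed
  then show "\<exists>q. \<forall>k. \<exists>C \<theta>. 0 < C \<and> 0 < \<theta> \<and> \<theta> < 1 \<and>
      (\<forall>n. jump_matrix m n powr (1 - \<theta>) * jump_matrix k n powr \<theta> \<le> C * jump_matrix q n)" by blast
qed

text \<open>
  A jump cannot lie in both of two consecutive steps from \<open>k\<close> to \<open>l\<close> and from \<open>l\<close> to \<open>m\<close>, so the sum
  of the two diameters always dominates \<open>exp (- \<delta> * expo n)\<close>.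
\<close>

lemma diametral_dimension_jump_space:
  "diametral_dimension (koethe_space jump_matrix :: (nat \<Rightarrow> 'a::real_normed_field) set) (koethe_norm jump_matrix) = subexponential expo"
  unfolding diametral_dimension_regular[OF koethe_jump_matrix regular_jump_matrix] jump_matrix_ratio
proof (intro equalityI subsetI CollectI allI)
  fix t :: "nat \<Rightarrow> 'a"
  assume "t \<in> {t. \<forall>k. \<exists>l>k. (\<lambda>n. norm (t n) * exp (- (slope l n - slope k n) * expo n)) \<longlonglongrightarrow> 0}"
  then have t: "\<exists>l>k. (\<lambda>n. norm (t n) * exp (- (slope l n - slope k n) * expo n)) \<longlonglongrightarrow> 0" for k by blast
  show "t \<in> subexponential expo"
    unfolding subexponential_def
  proof safe
    fix \<delta> :: real assume "0 < \<delta>"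
    then obtain k where k: "1 / real (Suc k) < \<delta>" using nat_approx_posE by (metis inverse_eq_divide)
    from t obtain l where l: "k < l" "(\<lambda>n. norm (t n) * exp (- (slope l n - slope k n) * expo n)) \<longlonglongrightarrow> 0" by blast
    from t obtain m where m: "l < m" "(\<lambda>n. norm (t n) * exp (- (slope m n - slope l n) * expo n)) \<longlonglongrightarrow> 0" by blast
    have bound: "norm (t n) * exp (- \<delta> * expo n) \<le>
        norm (t n) * exp (- (slope l n - slope k n) * expo n) + norm (t n) * exp (- (slope m n - slope l n) * expo n)" for n
    proof -
      have "1 / real (Suc l) \<le> 1 / real (Suc k)" using l by (simp add: frac_le)
      then have "slope l n - slope k n \<le> \<delta> \<or> slope m n - slope l n \<le> \<delta>"
        using slope_diff_le[of k l n] slope_diff_le[of l m n] l(1) m(1) k by (smt (verit) leD less_imp_le)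
      moreover have "exp (- \<delta> * expo n) \<le> exp (- x * expo n)" if "x \<le> \<delta>" for x
        using mult_right_mono[OF that, of "expo n"] expo_ge(2)[of n] by simp
      ultimately have "exp (- \<delta> * expo n) \<le> exp (- (slope l n - slope k n) * expo n) \<or>
          exp (- \<delta> * expo n) \<le> exp (- (slope m n - slope l n) * expo n)"
        by blast
      then have "exp (- \<delta> * expo n) \<le> exp (- (slope l n - slope k n) * expo n) + exp (- (slope m n - slope l n) * expo n)"
        by (smt (verit) exp_gt_zero)
      from mult_left_mono[OF this norm_ge_zero[of "t n"]] show ?thesis by (simp only: distrib_left)
    qed
    have lim: "(\<lambda>n. norm (t n) * exp (- (slope l n - slope k n) * expo n) + norm (t n) * exp (- (slope m n - slope l n) * expo n)) \<longlonglongrightarrow> 0"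
      using tendsto_add[OF l(2) m(2)] by (simp only: add_0)
    show "(\<lambda>n. norm (t n) * exp (- \<delta> * expo n)) \<longlonglongrightarrow> 0"
      by (rule tendsto_sandwich[OF _ always_eventually[OF allI[OF bound]] tendsto_const lim]) simp
  qed
next
  fix t :: "nat \<Rightarrow> 'a" and k
  assume t: "t \<in> subexponential expo"
  have "gap k * expo n \<le> (slope (Suc k) n - slope k n) * expo n" for n
    using expo_ge(2)[of n] by (intro mult_right_mono) (auto simp: slope_Suc)
  then have "(\<lambda>n. norm (t n) * exp (- (slope (Suc k) n - slope k n) * expo n)) \<longlonglongrightarrow> 0"
    by (intro tendsto_zero_norm_mult_le[OF subexponentialD[OF t gap_pos[of k]]])
       (simp_all only: exp_le_cancel_iff mult_minus_left neg_le_iff_le exp_ge_zero)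
  then show "\<exists>l>k. (\<lambda>n. norm (t n) * exp (- (slope l n - slope k n) * expo n)) \<longlonglongrightarrow> 0" by blast
qed

text \<open>
  Jumps of height \<open>m\<close> with \<open>m \<ge> p\<close> take place after the seminorm \<open>p\<close>. Choosing \<open>m > M\<close> as well,
  the quotients of the seminorms \<open>m + 1\<close> and \<open>p\<close> outgrow \<open>exp (M * expo n)\<close> along the fibre of \<open>m\<close>.
\<close>

lemma Lambda_1_not_isomorphic_to_subspace_of_jump_space:
  assumes \<gamma>: "exponent_sequence \<gamma>" and le: "\<And>n. \<gamma> n \<le> M * (expo n + 1)"
  shows "\<not> isomorphic_to_subspace (Lambda_1 \<gamma> :: (nat \<Rightarrow> 'a::real_normed_field) set) (Lambda_1_norm \<gamma>)
    (koethe_space jump_matrix) (koethe_norm jump_matrix)"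
proof
  assume "isomorphic_to_subspace (Lambda_1 \<gamma> :: (nat \<Rightarrow> 'a) set) (Lambda_1_norm \<gamma>)
    (koethe_space jump_matrix) (koethe_norm jump_matrix)"
  from isomorphic_subspace_ratio_bound[OF koethe_jump_matrix regular_jump_matrix power_series_matrix_1_koethe[OF \<gamma>] this, of 0]
  obtain p where p: "\<And>q. p \<le> q \<Longrightarrow> \<exists>l C. \<forall>n. jump_matrix q n / jump_matrix p n \<le>
      C * (power_series_matrix_1 \<gamma> l n / power_series_matrix_1 \<gamma> 0 n)" by blast
  obtain m :: nat where m: "p \<le> m" "M + 1 \<le> real m"
    using real_arch_simple[of "max (real p) (M + 1)"] by auto
  from p[of "Suc m"] m obtain l C where C: "\<And>n. jump_matrix (Suc m) n / jump_matrix p n \<le>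
      C * (power_series_matrix_1 \<gamma> l n / power_series_matrix_1 \<gamma> 0 n)" by auto
  have bound: "exp (expo n) \<le> \<bar>C\<bar> * exp M" if n: "jump n = m" for n
  proof -
    have "real m \<le> slope (Suc m) n - slope p n"
    proof -
      have "1 / real (Suc (Suc m)) \<le> 1 / real (Suc p)" using m by (intro frac_le) auto
      then show ?thesis using n m by (simp add: slope_def)
    qed
    then have "(M + 1) * expo n \<le> (slope (Suc m) n - slope p n) * expo n"
      using m expo_ge(2)[of n] by (intro mult_right_mono) auto
    then have "exp ((M + 1) * expo n) \<le> jump_matrix (Suc m) n / jump_matrix p n"
      by (simp add: jump_matrix_def algebra_simps flip: exp_diff)
    also have "\<dots> \<le> C * (power_series_matrix_1 \<gamma> l n / power_series_matrix_1 \<gamma> 0 n)" by (rule C)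
    also have "\<dots> \<le> \<bar>C\<bar> * exp (\<gamma> n)"
    proof (rule mult_mono)
      show "power_series_matrix_1 \<gamma> l n / power_series_matrix_1 \<gamma> 0 n \<le> exp (\<gamma> n)"
        unfolding power_series_matrix_1_def exp_diff[symmetric]
        using exponent_sequence_nonneg[OF \<gamma>, of n] by simp
    qed (auto simp: power_series_matrix_1_def)
    also have "\<dots> \<le> \<bar>C\<bar> * exp (M * (expo n + 1))" by (intro mult_left_mono) (auto simp: le)
    also have "\<dots> = \<bar>C\<bar> * exp M * exp (M * expo n)" by (simp add: distrib_left exp_add)
    finally have "exp (expo n) * exp (M * expo n) \<le> \<bar>C\<bar> * exp M * exp (M * expo n)"
      by (simp add: algebra_simps exp_add)
    then show ?thesis by (rule mult_right_le_imp_le) simp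
  qed
  define i where "i = nat \<lceil>\<bar>C\<bar> * exp M\<rceil>"
  define n where "n = prod_encode (m, i)"
  have "\<bar>C\<bar> * exp M \<le> real i" unfolding i_def by linarith
  also have "\<dots> \<le> real n" using le_prod_encode_2[of i m] by (simp add: n_def)
  also have "\<dots> \<le> expo n" by (rule expo_ge)
  also have "\<dots> < exp (expo n)" using exp_ge_add_one_self[of "expo n"] by linarith
  also have "\<dots> \<le> \<bar>C\<bar> * exp M" by (rule bound) (simp add: n_def jump_prod_encode)
  finally show False by simp
qed

theorem mainTheorem2:
  shows "\<exists>(a :: nat \<Rightarrow> nat \<Rightarrow> real) (E :: (nat \<Rightarrow> 'a::{real_normed_field, euclidean_space}) set) p.
    koethe_matrix a \<and> regular_matrix a \<and> E = koethe_space a \<and> p = koethe_norm a \<and>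
    nuclear_space E p \<and> property_DN_underlined E p \<and> property_Omega E p \<and>
    (\<exists>\<epsilon>. associated_exponent_sequence E p \<epsilon>) \<and>
    (\<forall>\<epsilon>. associated_exponent_sequence E p \<epsilon> \<longrightarrow>
       diametral_dimension E p = diametral_dimension (Lambda_1 \<epsilon>) (Lambda_1_norm \<epsilon>) \<and>
       \<not> isomorphic_to_subspace (Lambda_1 \<epsilon>) (Lambda_1_norm \<epsilon>) E p)"
proof -
  define E where "E = (koethe_space jump_matrix :: (nat \<Rightarrow> 'a) set)"
  define p where "p = (koethe_norm jump_matrix :: nat \<Rightarrow> (nat \<Rightarrow> 'a) \<Rightarrow> real)"
  have diam: "diametral_dimension E p = subexponential expo"
    unfolding E_def p_def by (rule diametral_dimension_jump_space)
  have "associated_exponent_sequence E p expo"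
    using exponent_sequence_expo summable_exp_expo diam by (rule associated_exponent_sequence_subexponential)
  moreover have "diametral_dimension E p = diametral_dimension (Lambda_1 \<epsilon>) (Lambda_1_norm \<epsilon>) \<and>
       \<not> isomorphic_to_subspace (Lambda_1 \<epsilon>) (Lambda_1_norm \<epsilon>) E p"
    if "associated_exponent_sequence E p \<epsilon>" for \<epsilon>
  proof -
    note unique = associated_exponent_sequence_unique[OF exponent_sequence_expo summable_exp_expo diam that]
    from unique(3) obtain M where "\<And>n. \<epsilon> n \<le> M * (expo n + 1)" by blast
    from Lambda_1_not_isomorphic_to_subspace_of_jump_space[OF unique(1) this] unique(2)
    show ?thesis unfolding E_def p_def by blast
  qed
  ultimately show ?thesis
    using koethe_jump_matrix regular_jump_matrix nuclear_jump_space[where 'a = 'a]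
      DN_underlined_jump_space[where 'a = 'a] Omega_jump_space[where 'a = 'a] E_def p_def
    by (intro exI[of _ jump_matrix] exI[of _ E] exI[of _ p]) auto
qed

end
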